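(* Let $\mathcal{G}$ be the (infinite) regular tree with degree $d>2$, endowed with weight $1/d$ on every edge. Then the critical value $u_*$ for percolation of the vacant set of random interlacements on $\mathcal{G}$ is $$u_*=\frac{d(d-1)\log(d-1)}{(d-2)^2}.$$
   Context: Weighted graphs. A weighted graph is a connected graph $(V,\mathcal{E})$ with $V$ countable and $\mathcal{E}\subset\{\{x,y\}\subset V;\ x\neq y\}$, together with a symmetric map $a:V\times V\to\mathbb{R}_+$ with $a_{x,y}>0$ iff $\{x,y\}\in\mathcal{E}$. Put $\mu_x=\sum_{y:\{x,y\}\in\mathcal{E}}a_{x,y}$. $P_x$ is the law of the random walk started at $x$ with transition probabilities $a_{x,y}/\mu_x$; the weighted graph is transient if this walk is transient (as is the case for the regular tree of degree $d>2$ with constant weights). Capacity. For finite $K\subset V$, $\mathrm{cap}(K)=\inf\{\frac12\sum_{x,y\in V}|f(x)-f(y)|^2a_{x,y};\ f:V\to\mathbb{R}\text{ finitely supported},\ f\equiv1\text{ on }K\}$. With $\widetilde H_K=\inf\{n\ge1;X_n\in K\}$ and $e_K(x)=1_{\{x\in K\}}P_x[\widetilde H_K=\infty]\mu_x$, one has $\mathrm{cap}(K)=\sum_{x\in K}e_K(x)$. Random interlacements. $W_+$ (resp. $W$) is the set of nearest-neighbor trajectories indexed by $\mathbb{N}=\{0,1,\dots\}$ (resp. $\mathbb{Z}$) that visit each vertex only finitely many times, with the $\sigma$-algebra generated by the canonical coordinates $X_n$. $W^*$ is the quotient of $W$ by time shift, with projection $\pi^*$ and the $\sigma$-algebra $\{A;(\pi^*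 )^{-1}(A)\text{ measurable}\}$; $W_K$ is the set of $w\in W$ entering $K$, and $W_K^*=\pi^*(W_K)$. There is a unique $\sigma$-finite measure $\nu$ on $W^*$ such that for each finite $K\subset V$, $1_{W_K^*}\cdot\nu$ is the image under $\pi^*$ of the measure $Q_K$ on $W_K$ given by $Q_K[(X_{-n})_{n\ge0}\in A,X_0=x,(X_n)_{n\ge0}\in B]=P_x[A\mid\widetilde H_K=\infty]\,e_K(x)\,P_x[B]$ for measurable $A,B\subset W_+$ and $x\in V$. Let $\mathbb{P}$ be the law of a Poisson point process $\omega=\sum_i\delta_{(w_i^*,u_i)}$ on $W^*\times\mathbb{R}_+$ with intensity $\nu(dw^* )\otimes du$. The vacant set at level $u\ge0$ is $\mathcal{V}^u=V\setminus\bigcup_{i:u_i\le u}\mathrm{Range}(w_i^* )$. The law $Q^u$ of $(1_{\{x\in\mathcal{V}^u\}})_{x\in V}$ on $\{0,1\}^V$ (with the $\sigma$-algebra generated by the coordinates $Y_x$) is the unique probability measure such that $Q^u[Y_x=1\text{ for all }x\in K]=\exp(-u\cdot\mathrm{cap}(K))$ for all finite $K\subset V$. Critical value. $\eta(u,x)=\mathbb{P}[\text{the connected component of }x\text{ in }\mathcal{V}^u\text{ is infinite}]$ and $u_*=\inf\{u\ge0;\eta(u,x)=0\}\in[0,\infty]$, which does not depend on $x\in V$. *)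

theory Defs
  imports "HOL-Probability.Probability"
begin

section \<open>Weighted graphs and regular trees\<close>

definition simple_graph :: "'v set \<Rightarrow> 'v set set \<Rightarrow> bool" where
  "simple_graph V E \<longleftrightarrow> E \<subseteq> {{x, y} | x y. x \<in> V \<and> y \<in> V \<and> x \<noteq> y}"

definition graph_connected :: "'v set \<Rightarrow> 'v set set \<Rightarrow> bool" where
  "graph_connected V E \<longleftrightarrow> (\<forall>x\<in>V. \<forall>y\<in>V. (x, y) \<in> {(u, v). {u, v} \<in> E}\<^sup>*)"

text \<open>The summability clause only says that \<open>\<mu>\<^sub>x\<close> below is finite, without which the
  transition probabilities \<open>a\<^sub>x\<^sub>,\<^sub>y / \<mu>\<^sub>x\<close> make no sense. It is automatic for locally
  finite graphs.\<close>

definition weighted_graph :: "'v set \<Rightarrow> 'v set set \<Rightarrow> ('v \<Rightarrow> 'v \<Rightarrow> real) \<Rightarrow> bool" where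
  "weighted_graph V E a \<longleftrightarrow>
     countable V \<and> simple_graph V E \<and> graph_connected V E \<and>
     (\<forall>x\<in>V. \<forall>y\<in>V. 0 \<le> a x y \<and> a x y = a y x \<and> (0 < a x y \<longleftrightarrow> {x, y} \<in> E)) \<and>
     (\<forall>x\<in>V. a x summable_on {y. {x, y} \<in> E})"

definition acyclic_graph :: "'v set set \<Rightarrow> bool" where
  "acyclic_graph E \<longleftrightarrow>
     \<not> (\<exists>c. 3 \<le> length c \<and> distinct c \<and>
          (\<forall>i<length c. {c ! i, c ! (Suc i mod length c)} \<in> E))"

definition regular_tree :: "'v set \<Rightarrow> 'v set set \<Rightarrow> nat \<Rightarrow> bool" where
  "regular_tree V E d \<longleftrightarrow>
     simple_graph V E \<and> graph_connected V E \<and> acyclic_graph E \<and>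
     (\<forall>x\<in>V. finite {y. {x, y} \<in> E} \<and> card {y. {x, y} \<in> E} = d)"


section \<open>The random walk\<close>

definition vertex_weight :: "'v set set \<Rightarrow> ('v \<Rightarrow> 'v \<Rightarrow> real) \<Rightarrow> 'v \<Rightarrow> real" where
  "vertex_weight E a x = (\<Sum>\<^sub>\<infinity>y\<in>{y. {x, y} \<in> E}. a x y)"

definition path_space :: "'v set \<Rightarrow> (nat \<Rightarrow> 'v) measure" where
  "path_space V = PiM UNIV (\<lambda>_. count_space V)"

text \<open>The law \<open>P\<^sub>x\<close>, on all of \<open>V\<^sup>\<nat>\<close>, is pinned down by its values on cylinders. That such a
  measure exists and is unique is \<open>random_walk_law_properties\<close> below.\<close>

definition is_random_walk_law ::
    "'v set \<Rightarrow> 'v set set \<Rightarrow> ('v \<Rightarrow> 'v \<Rightarrow> real) \<Rightarrow> 'v \<Rightarrow> (nat \<Rightarrow> 'v) measure \<Rightarrow> bool" where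
  "is_random_walk_law V E a x P \<longleftrightarrow>
     sets P = sets (path_space V) \<and>
     (\<forall>n y. (\<forall>i\<le>n. y i \<in> V) \<longrightarrow>
        emeasure P {w \<in> space (path_space V). \<forall>i\<le>n. w i = y i} =
          (if y 0 = x
           then ennreal (\<Prod>i<n. a (y i) (y (Suc i)) / vertex_weight E a (y i)) else 0))"

definition random_walk_law ::
    "'v set \<Rightarrow> 'v set set \<Rightarrow> ('v \<Rightarrow> 'v \<Rightarrow> real) \<Rightarrow> 'v \<Rightarrow> (nat \<Rightarrow> 'v) measure" where
  "random_walk_law V E a x = (THE P. is_random_walk_law V E a x P)"

text \<open>Existence, by the Ionescu-Tulcea theorem, and uniqueness of \<open>P\<^sub>x\<close>.\<close>

definition path_cylinder :: "'v set \<Rightarrow> nat \<Rightarrow> (nat \<Rightarrow> 'v) \<Rightarrow> (nat \<Rightarrow> 'v) set" where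
  "path_cylinder V n y = {w \<in> space (path_space V). \<forall>i\<le>n. w i = y i}"

lemma space_path_space: "space (path_space V) = UNIV \<rightarrow> V"
  by (simp add: path_space_def space_PiM PiE_UNIV_domain)

lemma sets_path_cylinder:
  assumes "\<forall>i\<le>n. y i \<in> V"
  shows "path_cylinder V n y \<in> sets (path_space V)"
proof -
  have "path_cylinder V n y =
      prod_emb UNIV (\<lambda>_. count_space V) {..n} (\<Pi>\<^sub>E i\<in>{..n}. {y i})"
    by (auto simp: path_cylinder_def prod_emb_def path_space_def space_PiM PiE_UNIV_domain)
  also have "\<dots> \<in> sets (path_space V)"
    unfolding path_space_def using assms by (intro sets_PiM_I) auto
  finally show ?thesis .
qed

lemma sets_path_space_cylinders:
  assumes "countable V"
  shows "sets (path_space V) = sigma_sets (UNIV \<rightarrow> V)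
           (insert {} {path_cylinder V n y | n y. \<forall>i\<le>n. y i \<in> V})" (is "_ = sigma_sets _ ?G")
proof
  show "sigma_sets (UNIV \<rightarrow> V) ?G \<subseteq> sets (path_space V)"
    unfolding space_path_space[symmetric]
    by (rule sets.sigma_sets_subset) (auto simp: sets_path_cylinder)
next
  have single: "{w \<in> UNIV \<rightarrow> V. w i \<in> B} \<in> sigma_sets (UNIV \<rightarrow> V) ?G" if "B \<subseteq> V" for i B
  proof -
    define Y where "Y = {y \<in> {..i} \<rightarrow>\<^sub>E V. y i \<in> B}"
    have "countable Y"
      unfolding Y_def using assms by (intro countable_subset[OF _ countable_PiE[of "{..i}" "\<lambda>_. V"]]) auto
    have "{w \<in> UNIV \<rightarrow> V. w i \<in> B} = (\<Union>y\<in>Y. path_cylinder V i y)" (is "?L = ?R")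
    proof
      show "?L \<subseteq> ?R"
      proof
        fix w assume "w \<in> ?L"
        then have "restrict w {..i} \<in> Y" "w \<in> path_cylinder V i (restrict w {..i})"
          by (auto simp: Y_def path_cylinder_def space_path_space)
        then show "w \<in> ?R" by blast
      qed
    qed (auto simp: Y_def path_cylinder_def space_path_space)
    moreover have "\<Union> (path_cylinder V i ` Y) \<in> sigma_sets (UNIV \<rightarrow> V) ?G"
    proof (rule sigma_sets_UNION)
      show "countable (path_cylinder V i ` Y)" using \<open>countable Y\<close> by simp
      fix b assume "b \<in> path_cylinder V i ` Y"
      then obtain y where "y \<in> Y" "b = path_cylinder V i y" by blast
      then have "b \<in> ?G" by (auto simp: Y_def)
      then show "b \<in> sigma_sets (UNIV \<rightarrow> V) ?G" by (rule sigma_sets.Basic)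
    qed
    ultimately show ?thesis by simp
  qed
  show "sets (path_space V) \<subseteq> sigma_sets (UNIV \<rightarrow> V) ?G"
    unfolding path_space_def sets_PiM_single space_PiM PiE_UNIV_domain space_count_space
    by (rule sigma_sets_mono) (auto intro: single)
qed

lemma is_random_walk_law_unique:
  assumes "countable V" "is_random_walk_law V E a x P" "is_random_walk_law V E a x P'"
  shows "P = P'"
proof (rule measure_eqI_generator_eq_countable)
  let ?G = "insert {} {path_cylinder V n y | n y. \<forall>i\<le>n. y i \<in> V}"
  show "Int_stable ?G"
  proof (rule Int_stableI)
    fix A B assume AB: "A \<in> ?G" "B \<in> ?G"
    show "A \<inter> B \<in> ?G"
    proof (cases "A \<inter> B = {}")
      case False
      then obtain w where w: "w \<in> A" "w \<in> B" by blast
      from AB w obtain n y m z where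
        A: "A = path_cylinder V n y" and B: "B = path_cylinder V m z" by auto
      have "A \<inter> B = path_cylinder V (max n m) w"
      proof (intro set_eqI iffI)
        fix v assume "v \<in> A \<inter> B"
        then show "v \<in> path_cylinder V (max n m) w"
          using w unfolding A B path_cylinder_def by (auto simp: le_max_iff_disj)
      next
        fix v assume "v \<in> path_cylinder V (max n m) w"
        then show "v \<in> A \<inter> B"
          using w unfolding A B path_cylinder_def by auto
      qed
      moreover have "w i \<in> V" for i
        using w unfolding A path_cylinder_def space_path_space by auto
      ultimately show ?thesis by blast
    qed simp
  qed
  show "?G \<subseteq> Pow (UNIV \<rightarrow> V)" by (auto simp: path_cylinder_def space_path_space)
  show "emeasure P X = emeasure P' X" if "X \<in> ?G" for X
    using that assms(2,3) by (auto simp: is_random_walk_law_def path_cylinder_def)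
  show "sets P = sigma_sets (UNIV \<rightarrow> V) ?G" "sets P' = sigma_sets (UNIV \<rightarrow> V) ?G"
    using assms sets_path_space_cylinders by (auto simp: is_random_walk_law_def)
  let ?A = "(\<lambda>z. path_cylinder V 0 (\<lambda>_. z)) ` V"
  show "?A \<subseteq> ?G" by auto
  show "\<Union> ?A = UNIV \<rightarrow> V" by (auto simp: path_cylinder_def space_path_space Pi_iff)
  show "countable ?A" using assms(1) by simp
  show "emeasure P b \<noteq> \<infinity>" if b: "b \<in> ?A" for b
  proof -
    from b obtain z where z: "z \<in> V" "b = path_cylinder V 0 (\<lambda>_. z)" by blast
    have "emeasure P b = (if z = x then ennreal 1 else 0)"
      using assms(2) z unfolding is_random_walk_law_def path_cylinder_def
      by (auto dest!: spec[of _ 0] spec[of _ "\<lambda>_::nat. z"])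
    then show ?thesis by auto
  qed
qed

definition step_law :: "'v set \<Rightarrow> 'v set set \<Rightarrow> ('v \<Rightarrow> 'v \<Rightarrow> real) \<Rightarrow> 'v \<Rightarrow> 'v measure" where
  "step_law V E a y = density (count_space V) (\<lambda>z. ennreal (a y z / vertex_weight E a y))"

lemma prob_space_step_law:
  assumes wg: "weighted_graph V E a" and y: "y \<in> V" and pos: "0 < vertex_weight E a y"
  shows "prob_space (step_law V E a y)"
proof
  let ?N = "{z. {y, z} \<in> E}"
  have NV: "?N \<subseteq> V"
    using wg by (fastforce simp: weighted_graph_def simple_graph_def doubleton_eq_iff)
  have nonneg: "0 \<le> a y z" if "z \<in> V" for z
    using wg y that by (auto simp: weighted_graph_def)
  have zero: "a y z = 0" if "z \<in> V - ?N" for z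
    using wg y that nonneg[of z] by (auto simp: weighted_graph_def less_le)
  have sumN: "a y summable_on ?N" using wg y by (auto simp: weighted_graph_def)
  have sumV: "a y summable_on V"
    using sumN NV zero by (subst summable_on_cong_neutral[of ?N _ "a y"]) auto
  have infV: "infsum (a y) V = vertex_weight E a y"
    unfolding vertex_weight_def using NV zero by (intro infsum_cong_neutral) auto
  define g where "g z = a y z / vertex_weight E a y" for z
  have g_nonneg: "0 \<le> g z" if "z \<in> V" for z using nonneg[OF that] pos by (simp add: g_def)
  have g_sum: "g summable_on V"
    unfolding g_def using sumV by (simp add: divide_inverse summable_on_cmult_left)
  have g_inf: "infsum g V = 1"
    unfolding g_def using infV pos by (simp add: divide_inverse infsum_cmult_left')
  have abs: "Infinite_Set_Sum.abs_summable_on g V"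
    unfolding abs_summable_equivalent[symmetric]
    using g_sum g_nonneg by (subst summable_on_cong[where g=g]) auto
  have "(\<integral>\<^sup>+z. ennreal (g z) \<partial>count_space V) = ennreal (infsetsum g V)"
    using abs g_nonneg by (intro nn_integral_conv_infsetsum) auto
  also have "infsetsum g V = 1" using infsetsum_infsum[OF abs] g_inf by simp
  finally show "emeasure (step_law V E a y) (space (step_law V E a y)) = 1"
    by (simp add: step_law_def emeasure_density g_def cong: nn_integral_cong_simp)
qed

lemma is_random_walk_law_exists:
  fixes V :: "'v set"
  assumes wg: "weighted_graph V E a" and pos: "\<forall>y\<in>V. 0 < vertex_weight E a y" and x: "x \<in> V"
  shows "\<exists>P. prob_space P \<and> is_random_walk_law V E a x P"
proof -
  define M where "M = (\<lambda>_::nat. count_space V)"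
  define K where "K i w = (if i = 0 then return (count_space V) x
                           else step_law V E a (w (i - 1)))" for i :: nat and w
  have step: "step_law V E a \<in> measurable (count_space V) (subprob_algebra (count_space V))"
    unfolding measurable_count_space_eq1 using prob_space_step_law[OF wg] pos
    by (auto simp: space_subprob_algebra step_law_def intro: prob_space_imp_subprob_space)
  interpret IT: Ionescu_Tulcea K M
  proof (rule Ionescu_Tulcea.intro)
    fix i
    show "K i \<in> measurable (PiM {0..<i} M) (subprob_algebra (M i))"
    proof (cases i)
      case 0
      then show ?thesis using x
        by (auto simp: K_def[abs_def] M_def space_subprob_algebra
                 intro!: measurable_const prob_space_imp_subprob_space prob_space_return)
    next
      case (Suc j)
      have "(\<lambda>w. w j) \<in> measurable (PiM {0..<i} M) (count_space V)"
        unfolding M_def using Suc by (intro measurable_component_singleton) auto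
      from measurable_compose[OF this step] Suc show ?thesis
        by (simp add: K_def[abs_def] M_def)
    qed
  next
    fix i w assume w: "w \<in> space (PiM {0..<i} M)"
    show "prob_space (K i w)"
    proof (cases i)
      case 0
      then show ?thesis using x by (simp add: K_def prob_space_return)
    next
      case (Suc j)
      then have "w j \<in> V" using w by (auto simp: space_PiM M_def PiE_iff)
      then show ?thesis using Suc pos prob_space_step_law[OF wg] by (simp add: K_def)
    qed
  qed
  have sing: "{restrict y {0..<n}} \<in> sets (PiM {0..<n} M)" if "\<forall>i<n. y i \<in> V" for n y
  proof -
    have "(\<Pi>\<^sub>E i\<in>{0..<n}. {y i}) \<in> sets (PiM {0..<n} M)"
      using that by (intro sets_PiM_I_finite) (auto simp: M_def)
    moreover have "(\<Pi>\<^sub>E i\<in>{0..<n}. {y i}) = {restrict y {0..<n}}"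
      by (auto simp: PiE_iff extensional_def restrict_def fun_eq_iff)
    ultimately show ?thesis by simp
  qed
  define k where "k y i = (case i of 0 \<Rightarrow> if y 0 = x then 1 else 0
                     | Suc j \<Rightarrow> a (y j) (y (Suc j)) / vertex_weight E a (y j))" for y :: "nat \<Rightarrow> 'v" and i
  have k_nonneg: "0 \<le> k y i" if "\<forall>j\<le>i. y j \<in> V" for y i
    using that wg pos by (auto simp: k_def weighted_graph_def split: nat.split intro!: divide_nonneg_pos)
  have K_sing: "emeasure (K n (restrict y {0..<n})) {y n} = ennreal (k y n)"
    if "\<forall>j\<le>n. y j \<in> V" for y n
  proof (cases n)
    case 0
    then show ?thesis using that by (auto simp: K_def k_def indicator_def)
  next
    case (Suc j)
    have "(\<integral>\<^sup>+z. f z * indicator {y n} z \<partial>count_space V) = f (y n)" for f :: "'v \<Rightarrow> ennreal"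
      using that by (subst nn_integral_indicator_singleton) (auto simp: one_ennreal_def[symmetric])
    with Suc that show ?thesis
      by (simp add: K_def k_def step_law_def emeasure_density)
  qed
  have C: "emeasure (IT.C 0 n (\<lambda>_. undefined)) {restrict y {0..<n}} = ennreal (\<Prod>i<n. k y i)"
    if "\<forall>i<n. y i \<in> V" for n y
    using that
  proof (induction n)
    case 0
    then show ?case by (auto simp: restrict_def PiM_empty)
  next
    case (Suc n)
    let ?u = "\<lambda>_. undefined"
    have u: "?u \<in> space (PiM {0..<0} M)" by simp
    have eP: "emeasure (IT.eP n w) {restrict y {0..<Suc n}} =
        ennreal (k y n) * indicator {restrict y {0..<n}} w"
      if w: "w \<in> space (PiM {0..<n} M)" for w
    proof -
      have ext: "w \<in> extensional {0..<n}" using w by (auto simp: space_PiM PiE_iff)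
      have eq: "w(n := z) = restrict y {0..<Suc n} \<longleftrightarrow> z = y n \<and> w = restrict y {0..<n}" for z
        using ext by (auto simp: fun_eq_iff restrict_def extensional_def less_Suc_eq)
      have vim: "(\<lambda>z. w(n := z)) -` {restrict y {0..<Suc n}} \<inter> space (M n) =
          (if w = restrict y {0..<n} then {y n} else {})"
      proof -
        have "(\<lambda>z. w(n := z)) -` {restrict y {0..<Suc n}} \<inter> space (M n) =
            {z \<in> V. w(n := z) = restrict y {0..<Suc n}}"
          unfolding M_def vimage_def space_count_space singleton_iff by blast
        also have "\<dots> = {z \<in> V. z = y n \<and> w = restrict y {0..<n}}"
          by (simp only: eq)
        finally show ?thesis using Suc.prems by auto
      qed
      have "emeasure (IT.eP n w) {restrict y {0..<Suc n}} =
          emeasure (K n w) ((\<lambda>z. w(n := z)) -` {restrict y {0..<Suc n}} \<inter> space (M n))"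
        using w sing[OF Suc.prems] by (rule IT.emeasure_eP)
      then show ?thesis
        unfolding vim using K_sing[of n y] Suc.prems by (auto simp: indicator_def less_Suc_eq_le)
    qed
    have singn: "{restrict y {0..<n}} \<in> sets (IT.C 0 n ?u)"
      using sing[of n y] Suc.prems IT.sets_C[OF u, of n] by auto
    have ne: "space (IT.C 0 n ?u) \<noteq> {}"
      using IT.prob_space_C[OF u] prob_space.not_empty by blast
    have meas: "IT.eP n \<in> measurable (IT.C 0 n ?u) (subprob_algebra (PiM {0..<Suc n} M))"
      using IT.measurable_eP[of n]
      by (subst measurable_cong_sets[OF IT.sets_C[OF u, of n] refl]) (simp only: add_0)
    have "emeasure (IT.C 0 (Suc n) ?u) {restrict y {0..<Suc n}} =
        (\<integral>\<^sup>+w. emeasure (IT.eP n w) {restrict y {0..<Suc n}} \<partial>IT.C 0 n ?u)"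
      using emeasure_bind[OF ne meas sing[OF Suc.prems]] by simp
    also have "\<dots> = (\<integral>\<^sup>+w. ennreal (k y n) * indicator {restrict y {0..<n}} w \<partial>IT.C 0 n ?u)"
      using IT.space_C[OF u, of n] by (intro nn_integral_cong eP) simp
    also have "\<dots> = ennreal (k y n) * emeasure (IT.C 0 n ?u) {restrict y {0..<n}}"
      using singn by (rule nn_integral_cmult_indicator)
    also have "\<dots> = ennreal (k y n) * ennreal (\<Prod>i<n. k y i)"
      by (subst Suc.IH) (use Suc.prems in auto)
    also have "\<dots> = ennreal (\<Prod>i<Suc n. k y i)"
      using Suc.prems k_nonneg
      by (subst ennreal_mult[symmetric]) (auto intro!: prod_nonneg simp: mult.commute)
    finally show ?case .
  qed
  let ?P = "IT.PF.lim"
  have "is_random_walk_law V E a x ?P"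
    unfolding is_random_walk_law_def
  proof (intro conjI allI impI)
    show "sets ?P = sets (path_space V)"
      using IT.PF.sets_lim by (simp add: path_space_def M_def[symmetric])
    fix n and y :: "nat \<Rightarrow> 'v" assume y: "\<forall>i\<le>n. y i \<in> V"
    then have y': "\<forall>i<Suc n. y i \<in> V" by (simp add: less_Suc_eq_le)
    let ?X = "{restrict y {0..<Suc n}}"
    have "{w \<in> space (path_space V). \<forall>i\<le>n. w i = y i} = IT.PF.emb UNIV {0..<Suc n} ?X"
    proof -
      have "restrict w {0..<Suc n} = restrict y {0..<Suc n} \<longleftrightarrow> (\<forall>i\<le>n. w i = y i)" for w :: "nat \<Rightarrow> 'v"
        by (force simp: fun_eq_iff restrict_def less_Suc_eq_le split: if_splits)
      then show ?thesis
        by (simp add: prod_emb_def path_space_def M_def space_PiM Int_def vimage_def conj_commute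
                 del: restrict_apply)
    qed
    then have "emeasure ?P {w \<in> space (path_space V). \<forall>i\<le>n. w i = y i} = emeasure (IT.CI {0..<Suc n}) ?X"
      using IT.lim[of "{0..<Suc n}" ?X] sing[OF y'] by simp
    also have "\<dots> = emeasure (IT.C 0 (Suc n) (\<lambda>_. undefined)) (IT.PF.emb {0..<Suc n} {0..<Suc n} ?X)"
      using sing[OF y'] by (intro IT.emeasure_CI) auto
    also have "IT.PF.emb {0..<Suc n} {0..<Suc n} ?X = ?X"
      using sets.sets_into_space[OF sing[OF y']] by (intro prod_emb_id) (simp add: space_PiM)
    also have "emeasure (IT.C 0 (Suc n) (\<lambda>_. undefined)) ?X = ennreal (\<Prod>i<Suc n. k y i)"
      using y' by (rule C)
    also have "(\<Prod>i<Suc n. k y i) =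
        (if y 0 = x then \<Prod>i<n. a (y i) (y (Suc i)) / vertex_weight E a (y i) else 0)"
      by (subst prod.lessThan_Suc_shift) (simp add: k_def)
    finally show "emeasure ?P {w \<in> space (path_space V). \<forall>i\<le>n. w i = y i} =
        (if y 0 = x
         then ennreal (\<Prod>i<n. a (y i) (y (Suc i)) / vertex_weight E a (y i)) else 0)"
      by simp
  qed
  moreover have "prob_space ?P"
  proof
    have "IT.PF.emb UNIV {} (space (PiM {} M)) = space ?P"
      by (auto simp: prod_emb_def IT.PF.space_lim space_PiM restrict_def)
    then have "emeasure ?P (space ?P) = emeasure (IT.CI {}) (space (PiM {} M))"
      using IT.lim[of "{}" "space (PiM {} M)"] by simp
    also have "space (PiM {} M) = space (IT.CI {})"
      by (simp add: IT.CI_def)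
    finally show "emeasure ?P (space ?P) = 1"
      using prob_space.emeasure_space_1[OF IT.PF.prob_space_P[of "{}"]] by simp
  qed
  ultimately show ?thesis by blast
qed

lemma random_walk_law_properties:
  assumes "weighted_graph V E a" "\<forall>y\<in>V. 0 < vertex_weight E a y" "x \<in> V"
  shows "is_random_walk_law V E a x (random_walk_law V E a x)"
    and "prob_space (random_walk_law V E a x)"
    and "is_random_walk_law V E a x P \<Longrightarrow> P = random_walk_law V E a x"
proof -
  from is_random_walk_law_exists[OF assms] obtain P0
    where P0: "prob_space P0" "is_random_walk_law V E a x P0" by blast
  have uniq: "P = P0" if "is_random_walk_law V E a x P" for P
    using is_random_walk_law_unique assms(1) that P0(2) by (metis weighted_graph_def)
  have eq: "random_walk_law V E a x = P0"
    unfolding random_walk_law_def using P0(2) uniq by (rule the_equality)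
  show "is_random_walk_law V E a x (random_walk_law V E a x)"
    "prob_space (random_walk_law V E a x)"
    unfolding eq by (fact P0)+
  show "P = random_walk_law V E a x" if "is_random_walk_law V E a x P"
    unfolding eq using that by (rule uniq)
qed

definition hitting_time :: "'v set \<Rightarrow> (nat \<Rightarrow> 'v) \<Rightarrow> enat" where
  "hitting_time K w = (INF n\<in>{n. 1 \<le> n \<and> w n \<in> K}. enat n)"

definition equilibrium_measure ::
    "'v set \<Rightarrow> 'v set set \<Rightarrow> ('v \<Rightarrow> 'v \<Rightarrow> real) \<Rightarrow> 'v set \<Rightarrow> 'v \<Rightarrow> real" where
  "equilibrium_measure V E a K x =
     (if x \<in> K
      then \<P>(w in random_walk_law V E a x. hitting_time K w = \<infinity>) * vertex_weight E a x
      else 0)"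


section \<open>Trajectory spaces\<close>

definition fwd_trajectories :: "'v set \<Rightarrow> 'v set set \<Rightarrow> (nat \<Rightarrow> 'v) set" where
  "fwd_trajectories V E =
     {w. (\<forall>n. w n \<in> V \<and> {w n, w (Suc n)} \<in> E) \<and> (\<forall>x\<in>V. finite {n. w n = x})}"

definition fwd_trajectory_space :: "'v set \<Rightarrow> 'v set set \<Rightarrow> (nat \<Rightarrow> 'v) measure" where
  "fwd_trajectory_space V E = restrict_space (path_space V) (fwd_trajectories V E)"

definition trajectories :: "'v set \<Rightarrow> 'v set set \<Rightarrow> (int \<Rightarrow> 'v) set" where
  "trajectories V E =
     {w. (\<forall>n. w n \<in> V \<and> {w n, w (n + 1)} \<in> E) \<and> (\<forall>x\<in>V. finite {n. w n = x})}"

definition trajectory_space :: "'v set \<Rightarrow> 'v set set \<Rightarrow> (int \<Rightarrow> 'v) measure" where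
  "trajectory_space V E =
     restrict_space (PiM UNIV (\<lambda>_. count_space V)) (trajectories V E)"

definition trajectories_entering ::
    "'v set \<Rightarrow> 'v set set \<Rightarrow> 'v set \<Rightarrow> (int \<Rightarrow> 'v) set" where
  "trajectories_entering V E K = {w \<in> trajectories V E. \<exists>n. w n \<in> K}"

definition shift_rel :: "'v set \<Rightarrow> 'v set set \<Rightarrow> ((int \<Rightarrow> 'v) \<times> (int \<Rightarrow> 'v)) set" where
  "shift_rel V E =
     {(w, w') \<in> trajectories V E \<times> trajectories V E. \<exists>k. \<forall>n. w' n = w (n + k)}"

definition shift_class :: "'v set \<Rightarrow> 'v set set \<Rightarrow> (int \<Rightarrow> 'v) \<Rightarrow> (int \<Rightarrow> 'v) set" where
  "shift_class V E w = shift_rel V E `` {w}"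

definition mod_trajectories :: "'v set \<Rightarrow> 'v set set \<Rightarrow> (int \<Rightarrow> 'v) set set" where
  "mod_trajectories V E = trajectories V E // shift_rel V E"

definition mod_trajectory_space :: "'v set \<Rightarrow> 'v set set \<Rightarrow> (int \<Rightarrow> 'v) set measure" where
  "mod_trajectory_space V E =
     sigma (mod_trajectories V E)
       {A. A \<subseteq> mod_trajectories V E \<and>
           shift_class V E -` A \<inter> trajectories V E \<in> sets (trajectory_space V E)}"

definition mod_trajectories_entering ::
    "'v set \<Rightarrow> 'v set set \<Rightarrow> 'v set \<Rightarrow> (int \<Rightarrow> 'v) set set" where
  "mod_trajectories_entering V E K = shift_class V E ` trajectories_entering V E K"

definition traj_range :: "(int \<Rightarrow> 'v) set \<Rightarrow> 'v set" where
  "traj_range ws = (\<Union>w\<in>ws. range w)"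


section \<open>The intensity measure\<close>

text \<open>The measure \<open>Q\<^sub>K\<close> is carried as a measure on the space of all doubly infinite trajectories;
  it charges only those with \<open>X\<^sub>0 \<in> K\<close>. When \<open>P\<^sub>x[hitting_time K = \<infinity>] = 0\<close> both the
  conditional probability (as \<open>0/0 = 0\<close>) and the equilibrium measure at \<open>x\<close> vanish.\<close>

definition is_Q_measure ::
    "'v set \<Rightarrow> 'v set set \<Rightarrow> ('v \<Rightarrow> 'v \<Rightarrow> real) \<Rightarrow> 'v set \<Rightarrow> (int \<Rightarrow> 'v) measure \<Rightarrow> bool" where
  "is_Q_measure V E a K Q \<longleftrightarrow>
     sets Q = sets (trajectory_space V E) \<and>
     (\<forall>A\<in>sets (fwd_trajectory_space V E). \<forall>B\<in>sets (fwd_trajectory_space V E). \<forall>x\<in>V.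
        emeasure Q {w \<in> trajectories V E.
            (\<lambda>n::nat. w (- int n)) \<in> A \<and> w 0 = x \<and> (\<lambda>n::nat. w (int n)) \<in> B} =
          ennreal (\<P>(w in random_walk_law V E a x. w \<in> A \<bar> hitting_time K w = \<infinity>)
                   * equilibrium_measure V E a K x
                   * \<P>(w in random_walk_law V E a x. w \<in> B)))"

definition is_interlacement_intensity ::
    "'v set \<Rightarrow> 'v set set \<Rightarrow> ('v \<Rightarrow> 'v \<Rightarrow> real) \<Rightarrow> (int \<Rightarrow> 'v) set measure \<Rightarrow> bool" where
  "is_interlacement_intensity V E a \<nu> \<longleftrightarrow>
     sets \<nu> = sets (mod_trajectory_space V E) \<and> sigma_finite_measure \<nu> \<and>
     (\<forall>K. finite K \<and> K \<subseteq> V \<longrightarrow>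
        (\<exists>Q. is_Q_measure V E a K Q \<and>
             density \<nu> (indicator (mod_trajectories_entering V E K)) =
               distr Q (mod_trajectory_space V E) (shift_class V E)))"


section \<open>Poisson point processes and the vacant set\<close>

text \<open>A point process is given by its (at most countably many) points: for an outcome \<open>\<omega>\<close> it is
  \<open>\<Sum>i\<in>I \<omega>. \<delta>\<^bsub>p \<omega> i\<^esub>\<close>, where points may be repeated. The next definition is the mass that this
  sum of Dirac measures gives to \<open>A\<close>.\<close>

definition point_count ::
    "('o \<Rightarrow> nat set) \<Rightarrow> ('o \<Rightarrow> nat \<Rightarrow> 'a) \<Rightarrow> 'a set \<Rightarrow> 'o \<Rightarrow> ennreal" where
  "point_count I p A \<omega> = (\<Sum>\<^sub>\<infinity>i\<in>I \<omega>. indicator A (p \<omega> i))"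

definition poisson_point_process ::
    "'o measure \<Rightarrow> 'a measure \<Rightarrow> ('o \<Rightarrow> nat set) \<Rightarrow> ('o \<Rightarrow> nat \<Rightarrow> 'a) \<Rightarrow> bool" where
  "poisson_point_process M \<Lambda> I p \<longleftrightarrow>
     prob_space M \<and>
     (\<forall>\<omega>\<in>space M. \<forall>i\<in>I \<omega>. p \<omega> i \<in> space \<Lambda>) \<and>
     (\<forall>A\<in>sets \<Lambda>. point_count I p A \<in> borel_measurable M) \<and>
     (\<forall>A\<in>sets \<Lambda>. emeasure \<Lambda> A < \<infinity> \<longrightarrow>
        (\<forall>k::nat. \<P>(\<omega> in M. point_count I p A \<omega> = of_nat k) =
                   exp (- measure \<Lambda> A) * measure \<Lambda> A ^ k / fact k)) \<and>
     (\<forall>A\<in>sets \<Lambda>. emeasure \<Lambda> A = \<infinity> \<longrightarrow> (AE \<omega> in M. point_count I p A \<omega> = \<infinity>)) \<and>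
     (\<forall>\<A>. finite \<A> \<and> \<A> \<subseteq> sets \<Lambda> \<and> disjoint \<A> \<longrightarrow>
        prob_space.indep_vars M (\<lambda>_. borel) (point_count I p) \<A>)"

text \<open>Random interlacements: the points \<open>p \<omega> i = (w\<^sub>i\<^sup>*, u\<^sub>i)\<close> are pairs of a trajectory modulo time
  shift and a level.\<close>

definition is_random_interlacement ::
    "'v set \<Rightarrow> 'v set set \<Rightarrow> ('v \<Rightarrow> 'v \<Rightarrow> real) \<Rightarrow> 'o measure \<Rightarrow>
     ('o \<Rightarrow> nat set) \<Rightarrow> ('o \<Rightarrow> nat \<Rightarrow> (int \<Rightarrow> 'v) set \<times> real) \<Rightarrow> bool" where
  "is_random_interlacement V E a M I p \<longleftrightarrow>
     (\<exists>\<nu>. is_interlacement_intensity V E a \<nu> \<and>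
          poisson_point_process M (\<nu> \<Otimes>\<^sub>M restrict_space lborel {0..}) I p)"

definition vacant_set ::
    "'v set \<Rightarrow> nat set \<Rightarrow> (nat \<Rightarrow> (int \<Rightarrow> 'v) set \<times> real) \<Rightarrow> real \<Rightarrow> 'v set" where
  "vacant_set V I p u = V - (\<Union>i\<in>{i \<in> I. snd (p i) \<le> u}. traj_range (fst (p i)))"

definition component :: "'v set set \<Rightarrow> 'v set \<Rightarrow> 'v \<Rightarrow> 'v set" where
  "component E S x =
     {y. x \<in> S \<and> (x, y) \<in> {(v, w). v \<in> S \<and> w \<in> S \<and> {v, w} \<in> E}\<^sup>*}"

definition percolation_prob ::
    "'v set \<Rightarrow> 'v set set \<Rightarrow> 'o measure \<Rightarrow>
     ('o \<Rightarrow> nat set) \<Rightarrow> ('o \<Rightarrow> nat \<Rightarrow> (int \<Rightarrow> 'v) set \<times> real) \<Rightarrow> real \<Rightarrow> 'v \<Rightarrow> real" where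
  "percolation_prob V E M I p u x =
     \<P>(\<omega> in M. infinite (component E (vacant_set V (I \<omega>) (p \<omega>) u) x))"

definition critical_value ::
    "'v set \<Rightarrow> 'v set set \<Rightarrow> 'o measure \<Rightarrow>
     ('o \<Rightarrow> nat set) \<Rightarrow> ('o \<Rightarrow> nat \<Rightarrow> (int \<Rightarrow> 'v) set \<times> real) \<Rightarrow> 'v \<Rightarrow> ereal" where
  "critical_value V E M I p x =
     Inf (ereal ` {u. 0 \<le> u \<and> percolation_prob V E M I p u x = 0})"

end

theory Submission
  imports Defs
begin

text \<open>On a tree the capacities of connected sets can be computed, and the vacant cluster of a vertex turns
out to behave like a cluster of independent site percolation with an explicit retention probability,
whose critical value on the tree is \<open>1 / (d - 1)\<close>.

All the weights \<open>\<mu>\<^sub>x\<close> equal 1. Root the tree at the given vertex \<open>r\<close> and let \<open>K\<close> be a finite connected set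
containing \<open>r\<close>. A walk leaving \<open>K\<close> enters a child of a vertex of \<open>K\<close>, from where it ever returns to
\<open>K\<close> with probability \<open>1 / (d - 1)\<close>; this hitting probability is found as the harmonic function off \<open>K\<close> that is
1 on \<open>K\<close> and vanishes at infinity (\<open>avoid_eq\<close>, \<open>escape_prob_ancestral\<close>). There are \<open>(d - 2) card K + 2\<close>
edges leaving \<open>K\<close> (\<open>card_outer_children\<close>), whence
\<open>cap(K) = (d - 2) / (d (d - 1)) \<cdot> ((d - 2) card K + 2)\<close>. This is also the \<open>\<nu>\<close>-mass of the trajectories that
enter \<open>K\<close> (\<open>intensity_entering\<close>): the walk is transient (\<open>AE_finite_visits\<close>), so no mass of \<open>Q\<^sub>K\<close> is lost on
paths outside the trajectory space. By the Poisson property, \<open>K\<close> is vacant at level \<open>u\<close> with probability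
\<open>s q\<^bsup>card K\<^esup>\<close>, where \<open>q = exp (- u (d - 2)\<^sup>2 / (d (d - 1)))\<close> and \<open>s\<close> depends only on \<open>u\<close> and \<open>d\<close>
(\<open>vacant_prob\<close>).

The component of \<open>r\<close> in the vacant set is infinite exactly when every generation contains a vertex whose
whole line of ancestors is vacant (\<open>infinite_component_iff\<close>). A line of ancestors, and the union of two
of them, is a connected set containing \<open>r\<close>, so the first two moments of the number of such vertices are
known. Generation \<open>n + 1\<close> has \<open>d (d - 1)\<^sup>n\<close> vertices: if \<open>q (d - 1) < 1\<close> the first moment tends to 0, and if
\<open>q (d - 1) > 1\<close> the second moment method gives a positive probability (\<open>percolation_dichotomy\<close>). The equation
\<open>q (d - 1) = 1\<close> is solved by \<open>u = d (d - 1) ln (d - 1) / (d - 2)\<^sup>2\<close>.\<close>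

section \<open>Rooting a regular tree\<close>

text \<open>A regular tree is used only through a choice of root \<open>r\<close>: every edge joins a vertex to its parent.
Setting \<open>par r = r\<close> makes \<open>par ^^ k\<close> total, so that ancestors need no side conditions on \<open>k\<close>.\<close>

locale rooted_regular_tree =
  fixes V :: "'v set" and E :: "'v set set" and d :: nat
    and r :: 'v and par :: "'v \<Rightarrow> 'v" and dep :: "'v \<Rightarrow> nat"
  assumes d_gt_2: "2 < d"
    and root_in_V: "r \<in> V"
    and par_root: "par r = r"
    and par_in_V: "y \<in> V \<Longrightarrow> par y \<in> V"
    and dep_root: "dep r = 0"
    and dep_par: "y \<in> V \<Longrightarrow> y \<noteq> r \<Longrightarrow> dep y = Suc (dep (par y))"
    and edge_iff: "{y, z} \<in> E \<longleftrightarrow>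
          y \<in> V \<and> z \<in> V \<and> (y \<noteq> r \<and> z = par y \<or> z \<noteq> r \<and> y = par z)"
    and finite_nbrs: "y \<in> V \<Longrightarrow> finite {z. {y, z} \<in> E}"
    and card_nbrs: "y \<in> V \<Longrightarrow> card {z. {y, z} \<in> E} = d"

lemma simple_graph_edgeD:
  assumes "simple_graph V E" "{x, y} \<in> E"
  shows "x \<in> V" "y \<in> V" "x \<noteq> y"
  using assms by (fastforce simp: simple_graph_def doubleton_eq_iff)+

text \<open>If the lines of ancestors of two adjacent vertices \<open>y\<close> and \<open>z\<close> first meet after \<open>i\<close> and \<open>j\<close> steps,
going up from \<open>y\<close> to the meeting point, down to \<open>z\<close> and back along the edge visits \<open>i + j + 1\<close>
distinct vertices. Acyclicity forces \<open>i + j \<le> 1\<close>, that is, one of the two is the parent of the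
other.\<close>

lemma edge_of_ancestors_meeting:
  assumes acyc: "acyclic_graph E" and edge: "{y, z} \<in> E" and yz: "y \<noteq> z"
    and i: "(par ^^ i) y = (par ^^ j) z"
    and ay: "\<And>k. k < i \<Longrightarrow> {(par ^^ k) y, (par ^^ Suc k) y} \<in> E"
    and az: "\<And>k. k < j \<Longrightarrow> {(par ^^ k) z, (par ^^ Suc k) z} \<in> E"
    and iny: "inj_on (\<lambda>k. (par ^^ k) y) {..i}"
    and inz: "inj_on (\<lambda>k. (par ^^ k) z) {..j}"
    and disj: "\<And>k l. k \<le> i \<Longrightarrow> l < j \<Longrightarrow> (par ^^ k) y \<noteq> (par ^^ l) z"
  shows "z = par y \<or> y = par z"
proof (rule ccontr)
  assume neg: "\<not> ?thesis"
  define c where "c = map (\<lambda>k. (par ^^ k) y) [0..<Suc i] @ rev (map (\<lambda>l. (par ^^ l) z) [0..<j])"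
  have len: "length c = Suc i + j" by (simp add: c_def)
  have nth1: "c ! k = (par ^^ k) y" if "k \<le> i" for k
    using that by (simp add: c_def nth_append del: upt_Suc)
  have nth2: "c ! k = (par ^^ (i + j - k)) z" if "i \<le> k" "k < Suc i + j" for k
  proof (cases "k = i")
    case True then show ?thesis using i nth1[of i] by simp
  next
    case False
    with that have "Suc i \<le> k" by simp
    then show ?thesis using that
      by (simp add: c_def nth_append rev_nth add.commute del: upt_Suc)
  qed
  have "3 \<le> length c"
  proof (rule ccontr)
    assume "\<not> 3 \<le> length c"
    then have "i + j = 0 \<or> (i = 1 \<and> j = 0) \<or> (i = 0 \<and> j = 1)" using len by auto
    then show False using i neg yz by auto
  qed
  moreover have "distinct c"
  proof -
    have "distinct (map (\<lambda>k. (par ^^ k) y) [0..<Suc i])"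
      using iny by (subst distinct_map) (auto simp: inj_on_def)
    moreover have "distinct (map (\<lambda>k. (par ^^ k) z) [0..<j])"
      using inz by (subst distinct_map) (auto simp: inj_on_def)
    ultimately show ?thesis using disj unfolding c_def by (auto simp del: upt_Suc)
  qed
  moreover have "{c ! k, c ! (Suc k mod length c)} \<in> E" if k: "k < length c" for k
  proof -
    consider "k < i" | "i \<le> k" "k < i + j" | "k = i + j" using k len by linarith
    then show ?thesis
    proof cases
      case 1
      then show ?thesis using ay[of k] nth1[of k] nth1[of "Suc k"] len by simp
    next
      case 2
      then have "Suc (i + j - Suc k) = i + j - k" by simp
      then show ?thesis using 2 az[of "i + j - Suc k"] nth2[of k] nth2[of "Suc k"] len
        by (simp add: insert_commute)
    next
      case 3
      then show ?thesis using nth2[of k] nth1[of 0] len edge by (simp add: insert_commute)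
    qed
  qed
  ultimately show False using acyc unfolding acyclic_graph_def by blast
qed

text \<open>The depth is the graph distance to \<open>r\<close>, and the parent is any neighbour closer to \<open>r\<close>. That this
choice accounts for all edges is the previous lemma, applied at the first meeting point of the two
lines of ancestors.\<close>

lemma regular_tree_rooted:
  assumes d: "2 < d" and tree: "regular_tree V E d" and r: "r \<in> V"
  obtains par dep where "rooted_regular_tree V E d r par dep"
proof -
  from tree have sg: "simple_graph V E" and conn: "graph_connected V E" and acyc: "acyclic_graph E"
    by (auto simp: regular_tree_def)
  note inV = simple_graph_edgeD[OF sg]
  define R where "R = {(u, v). {u, v} \<in> E}"
  define dep where "dep y = (LEAST n. (r, y) \<in> R ^^ n)" for y
  have ex: "\<exists>n. (r, y) \<in> R ^^ n" if "y \<in> V" for y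
    using conn r that unfolding graph_connected_def R_def[symmetric] by (auto dest: rtrancl_imp_relpow)
  have depI: "(r, y) \<in> R ^^ dep y" if "y \<in> V" for y
    unfolding dep_def using ex[OF that] by (rule LeastI_ex)
  have dep_le: "dep y \<le> n" if "(r, y) \<in> R ^^ n" for y n
    unfolding dep_def using that by (rule Least_le)
  have dep_r: "dep r = 0" using dep_le[of r 0] by simp
  have dep_pos: "dep y \<noteq> 0" if "y \<in> V" "y \<noteq> r" for y
    using depI[OF that(1)] that(2) by (metis relpow_0_E)
  have dep_step: "dep z \<le> Suc (dep y)" if "{y, z} \<in> E" for y z
    using relpow_Suc_I[OF depI[of y], of z] inV[OF that] that by (auto simp: R_def intro!: dep_le)
  have "\<exists>z. {y, z} \<in> E \<and> dep y = Suc (dep z)" if y: "y \<in> V" "y \<noteq> r" for y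
  proof -
    obtain n where n: "dep y = Suc n" using dep_pos[OF y] by (metis not0_implies_Suc)
    then obtain z where z: "(r, z) \<in> R ^^ n" "{z, y} \<in> E"
      using depI[OF y(1)] by (auto simp: R_def)
    have "dep z \<le> n" "dep y \<le> Suc (dep z)" using dep_le z dep_step by auto
    then show ?thesis using z n by (intro exI[of _ z]) (auto simp: insert_commute)
  qed
  then obtain par0 where par0: "\<And>y. y \<in> V \<Longrightarrow> y \<noteq> r \<Longrightarrow> {y, par0 y} \<in> E \<and> dep y = Suc (dep (par0 y))"
    by metis
  define par where "par y = (if y = r then r else par0 y)" for y
  have par_r: "par r = r" by (simp add: par_def)
  have par_edge: "{y, par y} \<in> E" "dep y = Suc (dep (par y))" if "y \<in> V" "y \<noteq> r" for y
    using par0[OF that] that by (auto simp: par_def)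
  have par_V: "par y \<in> V" if "y \<in> V" for y
    using inV[OF par_edge(1)[OF that]] r par_r that by (cases "y = r") auto
  have pow_V: "(par ^^ k) y \<in> V" if "y \<in> V" for k y
    using that par_V by (induction k) auto
  have dep_pow: "dep ((par ^^ k) y) = dep y - k" if "y \<in> V" for k y
  proof (induction k)
    case (Suc k)
    then show ?case using par_edge(2)[OF pow_V[OF that], of k] par_r dep_r
      by (cases "(par ^^ k) y = r") auto
  qed simp
  have inj: "inj_on (\<lambda>k. (par ^^ k) y) {..n}" if "y \<in> V" "n \<le> dep y" for y n
  proof (rule inj_onI)
    fix k l assume kl: "k \<in> {..n}" "l \<in> {..n}" "(par ^^ k) y = (par ^^ l) y"
    then have "dep y - k = dep y - l" using dep_pow[OF that(1)] by metis
    then show "k = l" using kl that by auto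
  qed
  have edges: "{(par ^^ k) y, (par ^^ Suc k) y} \<in> E" if "y \<in> V" "k < dep y" for y k
  proof -
    have "(par ^^ k) y \<noteq> r" using dep_pow[OF that(1), of k] that(2) dep_r by auto
    then show ?thesis using par_edge(1) pow_V[OF that(1)] by simp
  qed
  have top: "(par ^^ dep y) y = r" if "y \<in> V" for y
    using dep_pow[OF that, of "dep y"] dep_pos pow_V[OF that] by (metis diff_self_eq_0)
  have par_or: "z = par y \<or> y = par z" if e: "{y, z} \<in> E" for y z
  proof -
    note yz = inV[OF e]
    define P where "P i \<longleftrightarrow> (\<exists>j\<le>dep z. (par ^^ i) y = (par ^^ j) z)" for i
    define i where "i = (LEAST i. P i)"
    have Py: "P (dep y)" unfolding P_def using top yz by auto
    have "P i" unfolding i_def using Py by (rule LeastI)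
    have i_le: "i \<le> dep y" unfolding i_def using Py by (rule Least_le)
    have i_min: "\<not> P k" if "k < i" for k using that not_less_Least unfolding i_def by blast
    define j where "j = (LEAST j. (par ^^ i) y = (par ^^ j) z)"
    from \<open>P i\<close> obtain j0 where j0: "j0 \<le> dep z" "(par ^^ i) y = (par ^^ j0) z" by (auto simp: P_def)
    have j: "(par ^^ i) y = (par ^^ j) z" unfolding j_def using j0(2) by (rule LeastI)
    have j_le: "j \<le> dep z" using Least_le[of "\<lambda>j. (par ^^ i) y = (par ^^ j) z", OF j0(2)] j0(1)
      by (simp add: j_def)
    have j_min: "(par ^^ i) y \<noteq> (par ^^ k) z" if "k < j" for k
      using that not_less_Least unfolding j_def by blast
    show ?thesis
    proof (rule edge_of_ancestors_meeting[OF acyc e _ j])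
      show "(par ^^ k) y \<noteq> (par ^^ l) z" if "k \<le> i" "l < j" for k l
        using that i_min[of k] j_min[of l] j_le by (cases "k = i") (auto simp: P_def)
    qed (use yz i_le j_le edges inj in auto)
  qed
  have "rooted_regular_tree V E d r par dep"
  proof
    show "{y, z} \<in> E \<longleftrightarrow> y \<in> V \<and> z \<in> V \<and> (y \<noteq> r \<and> z = par y \<or> z \<noteq> r \<and> y = par z)" for y z
      using inV[of y z] par_or[of y z] par_edge(1)[of y] par_edge(1)[of z] par_r
      by (auto simp: insert_commute)
  qed (use d r par_r par_V dep_r par_edge tree in \<open>auto simp: regular_tree_def\<close>)
  then show thesis by (rule that)
qed

context rooted_regular_tree
begin

definition children :: "'v \<Rightarrow> 'v set" where
  "children y = {z \<in> V. z \<noteq> r \<and> par z = y}"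

lemma nbrs_eq:
  "y \<in> V \<Longrightarrow> {z. {y, z} \<in> E} = (if y = r then {} else {par y}) \<union> children y"
  using edge_iff[of y] par_in_V by (auto simp: children_def)

lemma dep_child: "z \<in> children y \<Longrightarrow> dep z = Suc (dep y)"
  using dep_par by (auto simp: children_def)

lemma par_notin_children: "y \<in> V \<Longrightarrow> y \<noteq> r \<Longrightarrow> par y \<notin> children y"
  using dep_child[of "par y" y] dep_par[of y] by auto

lemma finite_children: "y \<in> V \<Longrightarrow> finite (children y)"
  using finite_nbrs[of y] nbrs_eq[of y] by auto

lemma card_children:
  assumes "y \<in> V" shows "card (children y) = (if y = r then d else d - 1)"
  using card_nbrs[OF assms] nbrs_eq[OF assms] par_notin_children[OF assms] finite_children[OF assms]
  by (auto simp: card_insert_if)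

lemma sum_nbrs:
  fixes f :: "'v \<Rightarrow> real"
  assumes "y \<in> V"
  shows "(\<Sum>z | {y, z} \<in> E. f z) = (if y = r then 0 else f (par y)) + (\<Sum>z\<in>children y. f z)"
  using nbrs_eq[OF assms] par_notin_children[OF assms] finite_children[OF assms] by auto

lemma dep_eq_0_iff: "y \<in> V \<Longrightarrow> dep y = 0 \<longleftrightarrow> y = r"
  using dep_root dep_par by fastforce

lemma root_induct [consumes 1, case_names root par]:
  assumes "y \<in> V" "P r" "\<And>y. y \<in> V \<Longrightarrow> y \<noteq> r \<Longrightarrow> P (par y) \<Longrightarrow> P y"
  shows "P y"
  using assms(1)
proof (induction "dep y" arbitrary: y)
  case 0 then show ?case using dep_eq_0_iff assms(2) by auto
next
  case (Suc n)
  then show ?case using assms(3)[of y] dep_par[of y] par_in_V dep_root by (cases "y = r") auto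
qed

text \<open>The ancestral sets are the connected sets containing the root; closure under \<open>par\<close> is the form
in which connectedness is used. For such \<open>K\<close> a vertex outside \<open>K\<close> has all its children outside
\<open>K\<close>, which makes the distance to \<open>K\<close> (\<open>depth_below\<close>) grow by one along every child.\<close>

definition ancestral :: "'v set \<Rightarrow> bool" where
  "ancestral K \<longleftrightarrow> K \<subseteq> V \<and> r \<in> K \<and> par ` K \<subseteq> K"

definition depth_below :: "'v set \<Rightarrow> 'v \<Rightarrow> nat" where
  "depth_below K z = (LEAST k. (par ^^ k) z \<in> K)"

lemma depth_below_in: "z \<in> K \<Longrightarrow> depth_below K z = 0"
  by (simp add: depth_below_def)

lemma depth_below_step:
  assumes K: "ancestral K" and z: "z \<in> V" "z \<notin> K"
  shows "depth_below K z = Suc (depth_below K (par z))"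
proof -
  have "\<exists>k. (par ^^ k) z \<in> K"
    using z(1)
  proof (induction rule: root_induct)
    case root then show ?case using K by (intro exI[of _ 0]) (auto simp: ancestral_def)
  next
    case (par y)
    then obtain k where "(par ^^ k) (par y) \<in> K" by blast
    then show ?case by (intro exI[of _ "Suc k"]) (simp del: funpow.simps add: funpow_Suc_right)
  qed
  then obtain k where k: "(par ^^ k) z \<in> K" by blast
  show ?thesis unfolding depth_below_def
    by (subst Least_Suc[where P="\<lambda>k. (par ^^ k) z \<in> K", OF k]) (use z in \<open>simp_all del: funpow.simps(2) add: funpow_Suc_right\<close>)
qed

lemma child_notin: "ancestral K \<Longrightarrow> y \<notin> K \<Longrightarrow> z \<in> children y \<Longrightarrow> z \<notin> K"
  by (auto simp: ancestral_def children_def)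

lemma finite_depth_below:
  assumes K: "ancestral K" "finite K"
  shows "finite {y \<in> V. depth_below K y \<le> n}"
proof (induction n)
  case 0
  have "{y \<in> V. depth_below K y \<le> 0} \<subseteq> K" using depth_below_step[OF K(1)] by fastforce
  then show ?case using K(2) by (rule finite_subset)
next
  case (Suc n)
  have "{y \<in> V. depth_below K y \<le> Suc n} \<subseteq>
      K \<union> (\<Union>y\<in>{y \<in> V. depth_below K y \<le> n}. children y)"
  proof
    fix y assume y: "y \<in> {y \<in> V. depth_below K y \<le> Suc n}"
    show "y \<in> K \<union> (\<Union>y\<in>{y \<in> V. depth_below K y \<le> n}. children y)"
    proof (cases "y \<in> K")
      case False
      then have "y \<noteq> r" using K by (auto simp: ancestral_def)
      with y False show ?thesis using depth_below_step[OF K(1), of y] par_in_V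
        by (auto simp: children_def)
    qed simp
  qed
  then show ?case by (rule finite_subset) (use Suc K finite_children in auto)
qed

text \<open>This is the probability that the walk from \<open>y\<close> ever hits \<open>K\<close>: with \<open>d - 1\<close> children per vertex,
each generation between \<open>y\<close> and \<open>K\<close> costs a factor \<open>1 / (d - 1)\<close>, the solution \<open>\<rho> < 1\<close> of
\<open>d \<rho> = 1 + (d - 1) \<rho>\<^sup>2\<close>.\<close>

definition hit :: "'v set \<Rightarrow> 'v \<Rightarrow> real" where
  "hit K y = (1 / (real d - 1)) ^ depth_below K y"

lemma hit_in: "y \<in> K \<Longrightarrow> hit K y = 1"
  by (simp add: hit_def depth_below_in)

lemma hit_pos: "0 < hit K y"
  using d_gt_2 by (simp add: hit_def)

lemma hit_child:
  assumes "ancestral K" "z \<in> children y" "z \<notin> K"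
  shows "hit K z = hit K y / (real d - 1)"
  using depth_below_step[OF assms(1), of z] assms by (auto simp: hit_def children_def)

lemma hit_harmonic:
  assumes K: "ancestral K" and y: "y \<in> V" "y \<notin> K"
  shows "(\<Sum>z | {y, z} \<in> E. hit K z) = real d * hit K y"
proof -
  have yr: "y \<noteq> r" using K y by (auto simp: ancestral_def)
  have "hit K (par y) = (real d - 1) * hit K y"
    using depth_below_step[OF K y] d_gt_2 by (simp add: hit_def)
  moreover have "(\<Sum>z\<in>children y. hit K z) = (\<Sum>z\<in>children y. hit K y / (real d - 1))"
    using hit_child[OF K _ child_notin[OF K y(2)]] by (intro sum.cong) auto
  moreover have "\<dots> = hit K y"
    using card_children[OF y(1)] yr d_gt_2 by (simp add: of_nat_diff)
  ultimately show ?thesis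
    using sum_nbrs[OF y(1), of "hit K"] yr by (simp add: algebra_simps)
qed

lemma finite_hit_ge:
  assumes "ancestral K" "finite K" "0 < \<epsilon>"
  shows "finite {y \<in> V. \<epsilon> \<le> hit K y}"
proof -
  let ?q = "1 / (real d - 1)"
  have q: "0 \<le> ?q" "?q < 1" using d_gt_2 by auto
  obtain n where n: "?q ^ n < \<epsilon>" using real_arch_pow_inv[OF assms(3) q(2)] by blast
  have "{y \<in> V. \<epsilon> \<le> hit K y} \<subseteq> {y \<in> V. depth_below K y \<le> n}"
  proof clarify
    fix y assume "y \<in> V" "\<epsilon> \<le> hit K y"
    then have "?q ^ n < ?q ^ depth_below K y" using n by (simp add: hit_def)
    then show "depth_below K y \<le> n" using power_decreasing[of n "depth_below K y" ?q] q by linarith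
  qed
  then show ?thesis using finite_depth_below[OF assms(1,2)] by (rule finite_subset)
qed

lemma hit_smaller_nbr:
  assumes K: "ancestral K" and y: "y \<in> V" "y \<notin> K"
  shows "\<exists>z. {y, z} \<in> E \<and> hit K z < hit K y"
proof -
  have "card (children y) \<noteq> 0" using card_children[OF y(1)] d_gt_2 by auto
  then obtain z where z: "z \<in> children y" by (metis all_not_in_conv card.empty)
  have "hit K z = hit K y / (real d - 1)" using hit_child[OF K z child_notin[OF K y(2) z]] .
  moreover have "hit K y / (real d - 1) < hit K y" using hit_pos[of K y] d_gt_2
    by (simp add: field_simps)
  moreover have "{y, z} \<in> E" using nbrs_eq[OF y(1)] z by auto
  ultimately show ?thesis by auto
qed

text \<open>The vertices of \<open>K\<close> have \<open>d + (d - 1) (card K - 1)\<close> children in total, and the children lying in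
\<open>K\<close> are exactly the vertices of \<open>K\<close> other than the root.\<close>

lemma card_outer_children:
  assumes K: "ancestral K" "finite K"
  shows "real (\<Sum>y\<in>K. card (children y - K)) = (real d - 2) * real (card K) + 2"
proof -
  have KV: "K \<subseteq> V" and rK: "r \<in> K" using K by (auto simp: ancestral_def)
  have "(\<Sum>y\<in>K. card (children y \<inter> K)) = card (\<Union>y\<in>K. children y \<inter> K)"
    using K finite_children KV by (intro card_UN_disjoint[symmetric]) (auto simp: children_def)
  also have "(\<Union>y\<in>K. children y \<inter> K) = K - {r}"
    using K by (auto simp: children_def ancestral_def)
  finally have in_K: "(\<Sum>y\<in>K. card (children y \<inter> K)) = card K - 1" using rK K by simp
  have pos: "card K \<ge> 1" using rK K by (metis One_nat_def Suc_leI card_gt_0_iff empty_iff)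
  have "(\<Sum>y\<in>K. card (children y)) = (\<Sum>y\<in>{r}. card (children y)) + (\<Sum>y\<in>K-{r}. card (children y))"
    using K rK by (subst sum.union_disjoint[symmetric]) (auto intro: sum.cong simp: insert_absorb)
  also have "\<dots> = d + (card K - 1) * (d - 1)"
    using card_children KV rK K by (simp add: subset_iff)
  finally have all: "(\<Sum>y\<in>K. card (children y)) = d + (card K - 1) * (d - 1)" .
  have "card (children y) = card (children y - K) + card (children y \<inter> K)" if "y \<in> K" for y
    using finite_children[of y] that KV by (subst card_Un_disjoint[symmetric]) (auto intro: arg_cong[where f=card])
  then have "(\<Sum>y\<in>K. card (children y)) = (\<Sum>y\<in>K. card (children y - K)) + (\<Sum>y\<in>K. card (children y \<inter> K))"
    by (simp add: sum.distrib)
  with in_K all have "d + (card K - 1) * (d - 1) = (\<Sum>y\<in>K. card (children y - K)) + (card K - 1)" by simp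
  then have "real d + real (card K - 1) * real (d - 1) =
      real (\<Sum>y\<in>K. card (children y - K)) + real (card K - 1)"
    unfolding of_nat_add[symmetric] of_nat_mult[symmetric] of_nat_eq_iff .
  then have "real d + (real (card K) - 1) * (real d - 1) =
      real (\<Sum>y\<in>K. card (children y - K)) + (real (card K) - 1)"
    using pos d_gt_2 by (simp add: of_nat_diff)
  then show ?thesis by (simp add: algebra_simps)
qed

end

section \<open>The simple random walk on a regular tree\<close>

lemma all_nat_Suc: "(\<forall>n. Q n) \<longleftrightarrow> Q 0 \<and> (\<forall>n. Q (Suc n))"
  by (metis not0_implies_Suc)

locale tree_walk =
  fixes V :: "'v set" and E :: "'v set set" and a :: "'v \<Rightarrow> 'v \<Rightarrow> real" and d :: nat
  assumes d_gt_2: "2 < d"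
    and tree: "regular_tree V E d"
    and weighted: "weighted_graph V E a"
    and weight: "{y, z} \<in> E \<Longrightarrow> a y z = 1 / real d"
begin

abbreviation N :: "'v \<Rightarrow> 'v set" where "N y \<equiv> {z. {y, z} \<in> E}"

abbreviation P :: "'v \<Rightarrow> (nat \<Rightarrow> 'v) measure" where "P \<equiv> random_walk_law V E a"

lemma countable_V: "countable V"
  using weighted by (simp add: weighted_graph_def)

lemma N_subset: "N y \<subseteq> V"
  using tree simple_graph_edgeD(2) unfolding regular_tree_def by fastforce

lemma finite_N: "y \<in> V \<Longrightarrow> finite (N y)" and card_N: "y \<in> V \<Longrightarrow> card (N y) = d"
  using tree by (auto simp: regular_tree_def)

lemma N_nonempty: "y \<in> V \<Longrightarrow> N y \<noteq> {}"
  using card_N[of y] d_gt_2 by (metis card.empty not_less_zero)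

lemma vertex_weight_1: "y \<in> V \<Longrightarrow> vertex_weight E a y = 1"
  using finite_N[of y] card_N[of y] d_gt_2 by (simp add: vertex_weight_def weight)

lemma weight_eq: "y \<in> V \<Longrightarrow> z \<in> V \<Longrightarrow> a y z = (if {y, z} \<in> E then 1 / real d else 0)"
  using weight weighted by (auto simp: weighted_graph_def less_le)

lemma P_law: "y \<in> V \<Longrightarrow> is_random_walk_law V E a y (P y)"
  and prob_space_P: "y \<in> V \<Longrightarrow> prob_space (P y)"
  using random_walk_law_properties[OF weighted] vertex_weight_1 by auto

lemma sets_P: "y \<in> V \<Longrightarrow> sets (P y) = sets (path_space V)"
  using P_law by (auto simp: is_random_walk_law_def)

lemma space_P: "y \<in> V \<Longrightarrow> space (P y) = UNIV \<rightarrow> V"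
  using sets_eq_imp_space_eq[OF sets_P] by (simp add: space_path_space)

lemma P_cylinder:
  assumes "x \<in> V" "\<forall>i\<le>n. y i \<in> V"
  shows "emeasure (P x) (path_cylinder V n y) =
    (if y 0 = x then ennreal (\<Prod>i<n. if {y i, y (Suc i)} \<in> E then 1 / real d else 0) else 0)"
proof -
  have "(\<Prod>i<n. a (y i) (y (Suc i)) / vertex_weight E a (y i)) =
      (\<Prod>i<n. if {y i, y (Suc i)} \<in> E then 1 / real d else 0)"
    using assms(2) by (intro prod.cong) (simp_all add: weight_eq vertex_weight_1)
  then show ?thesis
    using P_law[OF assms(1)] assms(2) by (simp add: is_random_walk_law_def path_cylinder_def)
qed

lemma measurable_case_nat:
  "x \<in> V \<Longrightarrow> case_nat x \<in> measurable (path_space V) (path_space V)"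
  unfolding path_space_def
  by (rule measurable_PiM_single') (auto simp: space_PiM PiE_UNIV_domain Pi_iff split: nat.split)

text \<open>The Markov property at time one. The mixture over the neighbours \<open>z\<close> of \<open>x\<close> of the laws \<open>P z\<close>, with
\<open>x\<close> put in front of the path, has the cylinder probabilities that characterise \<open>P x\<close>.\<close>

lemma P_eq_mixture:
  assumes x: "x \<in> V" and A: "A \<in> sets (path_space V)"
  shows "emeasure (P x) A =
    (\<Sum>z\<in>N x. emeasure (P z) {w \<in> UNIV \<rightarrow> V. case_nat x w \<in> A}) / real d"
proof -
  \<comment> \<open>The value of the kernel off \<open>V\<close> is arbitrary; it only has to be a probability measure.\<close>
  define \<kappa> where "\<kappa> z = distr (P (if z \<in> V then z else x)) (path_space V) (case_nat x)" for z
  define P' where "P' = measure_pmf (pmf_of_set (N x)) \<bind> \<kappa>"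
  have meas: "case_nat x \<in> measurable (P z) (path_space V)" if "z \<in> V" for z
    using measurable_case_nat[OF x] sets_P[OF that] by (simp cong: measurable_cong_sets)
  have "prob_space (\<kappa> z)" for z
    unfolding \<kappa>_def using x by (intro prob_space.prob_space_distr prob_space_P meas) auto
  then have \<kappa>: "\<kappa> \<in> measurable (measure_pmf (pmf_of_set (N x))) (subprob_algebra (path_space V))"
    by (auto simp: space_subprob_algebra \<kappa>_def intro: prob_space_imp_subprob_space)
  have P': "emeasure P' B = (\<Sum>z\<in>N x. emeasure (P z) {w \<in> UNIV \<rightarrow> V. case_nat x w \<in> B}) / real d"
    if B: "B \<in> sets (path_space V)" for B
  proof -
    have "emeasure P' B = (\<integral>\<^sup>+z. emeasure (\<kappa> z) B \<partial>measure_pmf (pmf_of_set (N x)))"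
      unfolding P'_def by (rule emeasure_bind[OF _ \<kappa> B]) simp
    also have "\<dots> = (\<Sum>z\<in>N x. emeasure (\<kappa> z) B) / real d"
      using nn_integral_pmf_of_set[OF N_nonempty[OF x] finite_N[OF x]] card_N[OF x]
      by (simp add: ennreal_of_nat_eq_real_of_nat)
    also have "(\<Sum>z\<in>N x. emeasure (\<kappa> z) B) =
        (\<Sum>z\<in>N x. emeasure (P z) {w \<in> UNIV \<rightarrow> V. case_nat x w \<in> B})"
    proof (rule sum.cong)
      fix z assume "z \<in> N x"
      then have z: "z \<in> V" using N_subset by blast
      then have "emeasure (\<kappa> z) B = emeasure (P z) (case_nat x -` B \<inter> space (P z))"
        unfolding \<kappa>_def using meas[OF z] B by (simp add: emeasure_distr)
      also have "case_nat x -` B \<inter> space (P z) = {w \<in> UNIV \<rightarrow> V. case_nat x w \<in> B}"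
        using space_P[OF z] by auto
      finally show "emeasure (\<kappa> z) B = emeasure (P z) {w \<in> UNIV \<rightarrow> V. case_nat x w \<in> B}" .
    qed simp
    finally show ?thesis .
  qed
  have one: "emeasure (P z) (UNIV \<rightarrow> V) = 1" if "z \<in> V" for z
    using prob_space.emeasure_space_1[OF prob_space_P[OF that]] space_P[OF that] by simp
  have "is_random_walk_law V E a x P'"
    unfolding is_random_walk_law_def path_cylinder_def[symmetric]
  proof (intro conjI allI impI)
    show "sets P' = sets (path_space V)"
      unfolding P'_def by (rule sets_bind[OF _ ]) (auto simp: \<kappa>_def)
    fix n and y :: "nat \<Rightarrow> 'v" assume y: "\<forall>i\<le>n. y i \<in> V"
    have "emeasure P' (path_cylinder V n y) = emeasure (P x) (path_cylinder V n y)"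
    proof (cases n)
      case 0
      have "{w \<in> UNIV \<rightarrow> V. case_nat x w \<in> path_cylinder V n y} = (if y 0 = x then UNIV \<rightarrow> V else {})"
        using x y 0 by (auto simp: path_cylinder_def space_path_space Pi_iff split: nat.split)
      then have "emeasure P' (path_cylinder V n y) =
          (\<Sum>z\<in>N x. if y 0 = x then 1 else 0 :: ennreal) / ennreal (real d)"
        using one subsetD[OF N_subset[of x]] by (subst P'[OF sets_path_cylinder[OF y]])
          (intro arg_cong[where f="\<lambda>s. s / _"] sum.cong, auto)
      also have "\<dots> = (if y 0 = x then 1 else 0)"
        using card_N[OF x] d_gt_2
        by (auto simp: ennreal_of_nat_eq_real_of_nat divide_ennreal)
      also have "\<dots> = emeasure (P x) (path_cylinder V n y)"
        using P_cylinder[OF x y] 0 by simp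
      finally show ?thesis .
    next
      case (Suc m)
      have y': "\<forall>i\<le>m. y (Suc i) \<in> V" using y Suc by auto
      have le: "(\<forall>i\<le>Suc m. R i) \<longleftrightarrow> R 0 \<and> (\<forall>i\<le>m. R (Suc i))" for R
        using All_less_Suc2[of "Suc m" R] by (simp only: less_Suc_eq_le)
      have "{w \<in> UNIV \<rightarrow> V. case_nat x w \<in> path_cylinder V n y} =
          (if y 0 = x then path_cylinder V m (\<lambda>i. y (Suc i)) else {})"
        using x unfolding path_cylinder_def space_path_space Suc le
        by (auto simp: Pi_iff split: nat.split)
      then have "emeasure P' (path_cylinder V n y) =
          (\<Sum>z\<in>N x. if y 0 = x \<and> z = y 1
             then ennreal (\<Prod>i<m. if {y (Suc i), y (Suc (Suc i))} \<in> E then 1 / real d else 0) else 0) / real d"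
        using subsetD[OF N_subset[of x]] P_cylinder[OF _ y']
        by (subst P'[OF sets_path_cylinder[OF y]])
          (intro arg_cong[where f="\<lambda>s. s / _"] sum.cong, auto)
      also have "\<dots> = (if y 0 = x \<and> y 1 \<in> N x
             then ennreal (\<Prod>i<m. if {y (Suc i), y (Suc (Suc i))} \<in> E then 1 / real d else 0) else 0) / real d"
        using finite_N[OF x] by (cases "y 0 = x") (auto simp: sum.delta)
      also have "\<dots> = emeasure (P x) (path_cylinder V n y)"
        using P_cylinder[OF x y] d_gt_2 unfolding Suc
        by (auto simp: prod.lessThan_Suc_shift divide_ennreal prod_nonneg simp del: prod.lessThan_Suc)
      finally show ?thesis .
    qed
    then show "emeasure P' (path_cylinder V n y) = (if y 0 = x
         then ennreal (\<Prod>i<n. a (y i) (y (Suc i)) / vertex_weight E a (y i)) else 0)"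
      using P_law[OF x] y by (simp add: is_random_walk_law_def path_cylinder_def)
  qed
  from is_random_walk_law_unique[OF countable_V this P_law[OF x]] P'[OF A]
  show ?thesis by simp
qed

lemma prob_step:
  assumes x: "x \<in> V" and A: "{w \<in> UNIV \<rightarrow> V. Q w} \<in> sets (path_space V)"
  shows "measure (P x) {w \<in> UNIV \<rightarrow> V. Q w} =
    (\<Sum>z\<in>N x. measure (P z) {w \<in> UNIV \<rightarrow> V. Q (case_nat x w)}) / real d"
proof -
  have eq: "{w \<in> UNIV \<rightarrow> V. case_nat x w \<in> {w \<in> UNIV \<rightarrow> V. Q w}} = {w \<in> UNIV \<rightarrow> V. Q (case_nat x w)}"
    using x by (auto simp: Pi_iff split: nat.split)
  have fin: "emeasure (P z) B = ennreal (measure (P z) B)" if "z \<in> V" for z B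
    using finite_measure.emeasure_eq_measure[OF prob_space.finite_measure[OF prob_space_P[OF that]]] .
  have "ennreal (measure (P x) {w \<in> UNIV \<rightarrow> V. Q w}) =
      (\<Sum>z\<in>N x. ennreal (measure (P z) {w \<in> UNIV \<rightarrow> V. Q (case_nat x w)})) / real d"
    using P_eq_mixture[OF x A] unfolding eq fin[OF x]
    using fin N_subset[of x] by (subst sum.cong[OF refl fin[symmetric]]) auto
  also have "\<dots> = ennreal ((\<Sum>z\<in>N x. measure (P z) {w \<in> UNIV \<rightarrow> V. Q (case_nat x w)}) / real d)"
    using d_gt_2 by (simp add: divide_ennreal sum_nonneg)
  finally show ?thesis using d_gt_2 by (simp add: sum_nonneg)
qed

lemma measurable_coord [measurable]: "(\<lambda>w. w n) \<in> measurable (path_space V) (count_space V)"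
  unfolding path_space_def by (rule measurable_component_singleton) simp

lemma sets_coord_in: "{w \<in> UNIV \<rightarrow> V. w n \<in> B} \<in> sets (path_space V)"
proof -
  have "(\<lambda>w. w n) -` (B \<inter> V) \<inter> space (path_space V) \<in> sets (path_space V)"
    by (rule measurable_sets[OF measurable_coord]) auto
  moreover have "(\<lambda>w. w n) -` (B \<inter> V) \<inter> space (path_space V) = {w \<in> UNIV \<rightarrow> V. w n \<in> B}"
    by (auto simp: space_path_space)
  ultimately show ?thesis by simp
qed

lemma sets_edge: "{w \<in> UNIV \<rightarrow> V. {w n, w (Suc n)} \<in> E} \<in> sets (path_space V)"
proof -
  have "{w \<in> UNIV \<rightarrow> V. {w n, w (Suc n)} \<in> E} =
      (\<Union>y\<in>V. {w \<in> UNIV \<rightarrow> V. w n \<in> {y}} \<inter> {w \<in> UNIV \<rightarrow> V. w (Suc n) \<in> N y})"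
    by auto
  also have "\<dots> \<in> sets (path_space V)"
    using countable_V by (intro sets.countable_UN' image_subsetI sets.Int sets_coord_in)
  finally show ?thesis .
qed

lemma sets_finite_visits: "{w \<in> UNIV \<rightarrow> V. finite {n. w n = z}} \<in> sets (path_space V)"
proof -
  have fin: "finite {n. w n = z} \<longleftrightarrow> (\<exists>m. \<forall>n\<ge>m. w n \<noteq> z)" for w :: "nat \<Rightarrow> 'v"
    unfolding finite_nat_set_iff_bounded mem_Collect_eq Ball_def by (metis not_less)
  have "{w \<in> UNIV \<rightarrow> V. finite {n. w n = z}} =
      (\<Union>m. \<Inter>n\<in>{m::nat..}. {w \<in> UNIV \<rightarrow> V. w n \<in> - {z}})"
    unfolding fin by auto
  also have "\<dots> \<in> sets (path_space V)"
    by (intro sets.countable_UN' sets.countable_INT' image_subsetI sets_coord_in) auto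
  finally show ?thesis .
qed

lemma prob_UNIV: "x \<in> V \<Longrightarrow> measure (P x) (UNIV \<rightarrow> V) = 1"
  using prob_space.prob_space[OF prob_space_P] space_P by metis

lemma prob_start: "x \<in> V \<Longrightarrow> measure (P x) {w \<in> UNIV \<rightarrow> V. w 0 \<in> B} = (if x \<in> B then 1 else 0)"
  using prob_step[OF _ sets_coord_in[of 0 B]] card_N[of x] d_gt_2 prob_UNIV N_subset[of x]
  by (auto simp: subset_iff)

lemma prob_edge: "x \<in> V \<Longrightarrow> measure (P x) {w \<in> UNIV \<rightarrow> V. {w n, w (Suc n)} \<in> E} = 1"
proof (induction n arbitrary: x)
  case 0
  have "(\<Sum>z\<in>N x. measure (P z) {w \<in> UNIV \<rightarrow> V. w 0 \<in> N x}) = (\<Sum>z\<in>N x. 1)"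
    using N_subset[of x] prob_start[of _ "N x"] by (intro sum.cong) auto
  with prob_step[OF 0 sets_edge[of 0]] card_N[OF 0] d_gt_2 show ?case by simp
next
  case (Suc n)
  have "(\<Sum>z\<in>N x. measure (P z) {w \<in> UNIV \<rightarrow> V. {w n, w (Suc n)} \<in> E}) = (\<Sum>z\<in>N x. 1)"
    using N_subset[of x] Suc.IH by (intro sum.cong) auto
  with prob_step[OF Suc.prems sets_edge[of "Suc n"]] card_N[OF Suc.prems] d_gt_2 show ?case by simp
qed

text \<open>Every visit of the walk to \<open>z\<close> lowers the expected value of \<open>g\<close> along the walk by at least \<open>c\<close>, and
this value never becomes negative.\<close>

lemma green_bound:
  assumes z: "z \<in> V" and c: "0 < c" and g0: "\<And>y. y \<in> V \<Longrightarrow> 0 \<le> g y"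
    and g: "\<And>y. y \<in> V \<Longrightarrow> (\<Sum>y'\<in>N y. g y') / real d \<le> g y - (if y = z then c else 0)"
  shows "y \<in> V \<Longrightarrow> c * (\<Sum>k<n. measure (P y) {w \<in> UNIV \<rightarrow> V. w k = z}) \<le> g y"
proof (induction n arbitrary: y)
  case 0 then show ?case using g0 by simp
next
  case (Suc n)
  let ?G = "\<lambda>n y. \<Sum>k<n. measure (P y) {w \<in> UNIV \<rightarrow> V. w k = z}"
  have "?G (Suc n) y = (if y = z then 1 else 0) + (\<Sum>k<n. measure (P y) {w \<in> UNIV \<rightarrow> V. w (Suc k) = z})"
    unfolding sum.lessThan_Suc_shift using prob_start[OF Suc.prems, of "{z}"] by simp
  also have "(\<Sum>k<n. measure (P y) {w \<in> UNIV \<rightarrow> V. w (Suc k) = z}) = (\<Sum>y'\<in>N y. ?G n y') / real d"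
    using prob_step[OF Suc.prems, where Q="\<lambda>w. w (Suc k) = z" for k] sets_coord_in[where B="{z}"]
    by (subst sum.swap) (simp add: sum_divide_distrib)
  finally have "c * ?G (Suc n) y = (if y = z then c else 0) + (\<Sum>y'\<in>N y. c * ?G n y') / real d"
    by (simp add: algebra_simps sum_distrib_left)
  also have "(\<Sum>y'\<in>N y. c * ?G n y') \<le> (\<Sum>y'\<in>N y. g y')"
    using Suc.IH N_subset by (intro sum_mono) auto
  then have "(if y = z then c else 0) + (\<Sum>y'\<in>N y. c * ?G n y') / real d \<le>
      (if y = z then c else 0) + (\<Sum>y'\<in>N y. g y') / real d"
    by (intro add_left_mono divide_right_mono) auto
  also have "\<dots> \<le> g y" using g[OF Suc.prems] by simp
  finally show ?case .
qed

text \<open>Transience. With the root placed at \<open>z\<close>, the function \<open>hit {z}\<close> is harmonic off \<open>z\<close> and strictly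
superharmonic at \<open>z\<close>, so the expected number of visits to \<open>z\<close> is finite and the Borel-Cantelli
lemma applies.\<close>

lemma AE_finite_visits:
  assumes y: "y \<in> V" and z: "z \<in> V"
  shows "AE w in P y. finite {n. w n = z}"
proof -
  obtain par dep where rt: "rooted_regular_tree V E d z par dep"
    using regular_tree_rooted[OF d_gt_2 tree z] .
  interpret rooted_regular_tree V E d z par dep by (fact rt)
  have K: "ancestral {z}" using z par_root by (simp add: ancestral_def)
  let ?g = "hit {z}" and ?c = "1 - 1 / (real d - 1)"
  have c: "0 < ?c" using d_gt_2 by (simp add: field_simps)
  have g: "(\<Sum>y'\<in>N y. ?g y') / real d \<le> ?g y - (if y = z then ?c else 0)" if "y \<in> V" for y
  proof (cases "y = z")
    case True
    have "(\<Sum>y'\<in>children z. ?g y') = (\<Sum>y'\<in>children z. 1 / (real d - 1))"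
      using hit_child[OF K] by (intro sum.cong) (auto simp: children_def hit_in)
    then have "(\<Sum>y'\<in>N z. ?g y') = real d / (real d - 1)"
      using sum_nbrs[OF z, of ?g] card_children[OF z] by simp
    then show ?thesis using True d_gt_2 by (simp add: hit_in)
  next
    case False
    then show ?thesis using hit_harmonic[OF K that] d_gt_2 by simp
  qed
  have le: "?c * (\<Sum>k<n. measure (P y) {w \<in> UNIV \<rightarrow> V. w k = z}) \<le> ?g y" for n
    using green_bound[OF z c _ g y] hit_pos less_imp_le by blast
  have "summable (\<lambda>k. measure (P y) {w \<in> UNIV \<rightarrow> V. w k = z})"
  proof (rule bounded_imp_summable)
    show "(\<Sum>k\<le>n. measure (P y) {w \<in> UNIV \<rightarrow> V. w k = z}) \<le> ?g y / ?c" for n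
      using le[of "Suc n"] by (simp only: pos_le_divide_eq[OF c] lessThan_Suc_atMost mult.commute)
  qed simp
  then have "AE w in P y. eventually (\<lambda>k. w \<in> space (P y) - {w \<in> UNIV \<rightarrow> V. w k = z}) sequentially"
    using y sets_coord_in[where B="{z}"] prob_space.finite_measure[OF prob_space_P]
    by (intro borel_cantelli_AE1)
      (auto simp: sets_P finite_measure.emeasure_finite less_top[symmetric])
  then show ?thesis
  proof (eventually_elim)
    case (elim w)
    then obtain m where "\<forall>n\<ge>m. w \<in> space (P y) - {w \<in> UNIV \<rightarrow> V. w n = z}"
      by (auto simp: eventually_sequentially)
    then have "{n. w n = z} \<subseteq> {..<m}" using space_P[OF y] by (auto simp: not_le[symmetric])
    then show ?case by (rule finite_subset) simp
  qed
qed

lemma sets_fwd_trajectories: "fwd_trajectories V E \<in> sets (path_space V)"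
proof -
  have "fwd_trajectories V E = (\<Inter>n. {w \<in> UNIV \<rightarrow> V. {w n, w (Suc n)} \<in> E}) \<inter>
      ((UNIV \<rightarrow> V) \<inter> (\<Inter>x\<in>V. {w \<in> UNIV \<rightarrow> V. finite {n. w n = x}}))"
    by (auto simp: fwd_trajectories_def Pi_iff)
  also have "\<dots> \<in> sets (path_space V)"
  proof (cases "V = {}")
    case False
    then show ?thesis
      using sets_edge sets_finite_visits countable_V sets.top[of "path_space V"]
      by (intro sets.Int sets.countable_INT' sets.countable_INT'') (auto simp: space_path_space)
  qed (auto simp: Pi_def)
  finally show ?thesis .
qed

lemma AE_fwd_trajectories: "y \<in> V \<Longrightarrow> AE w in P y. w \<in> fwd_trajectories V E"
proof -
  assume y: "y \<in> V"
  interpret prob_space "P y" using prob_space_P[OF y] .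
  have "AE w in P y. \<forall>n. {w n, w (Suc n)} \<in> E"
    unfolding AE_all_countable
  proof
    fix n
    have "prob {w \<in> UNIV \<rightarrow> V. {w n, w (Suc n)} \<in> E} = 1" using prob_edge[OF y] .
    then have "AE w in P y. w \<in> {w \<in> UNIV \<rightarrow> V. {w n, w (Suc n)} \<in> E}"
      using prob_eq_1[of "{w \<in> UNIV \<rightarrow> V. {w n, w (Suc n)} \<in> E}"] sets_edge[of n] sets_P[OF y] by simp
    then show "AE w in P y. {w n, w (Suc n)} \<in> E" by eventually_elim simp
  qed
  moreover have "AE w in P y. \<forall>z\<in>V. finite {n. w n = z}"
    using countable_V AE_finite_visits[OF y] by (simp add: AE_ball_countable)
  moreover have "AE w in P y. w \<in> UNIV \<rightarrow> V" using AE_space space_P[OF y] by auto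
  ultimately show ?thesis by eventually_elim (auto simp: fwd_trajectories_def)
qed

definition avoid :: "'v set \<Rightarrow> 'v \<Rightarrow> real" where
  "avoid K y = measure (P y) {w \<in> UNIV \<rightarrow> V. \<forall>n. w n \<notin> K}"

definition avoid_until :: "'v set \<Rightarrow> nat \<Rightarrow> 'v \<Rightarrow> real" where
  "avoid_until K n y = measure (P y) {w \<in> UNIV \<rightarrow> V. \<forall>i<n. w i \<notin> K}"

lemma sets_avoid: "{w \<in> UNIV \<rightarrow> V. \<forall>n\<in>S. w n \<notin> K} \<in> sets (path_space V)"
proof -
  have "{w \<in> UNIV \<rightarrow> V. \<forall>n\<in>S. w n \<notin> K} = (UNIV \<rightarrow> V) \<inter> (\<Inter>n. {w \<in> UNIV \<rightarrow> V. n \<in> S \<longrightarrow> w n \<in> - K})"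
    by auto
  moreover have "{w \<in> UNIV \<rightarrow> V. n \<in> S \<longrightarrow> w n \<in> - K} \<in> sets (path_space V)" for n
    using sets_coord_in[of n "- K"] sets_coord_in[of n UNIV] by (cases "n \<in> S") auto
  ultimately show ?thesis
    using sets.top[of "path_space V"] by (auto simp: space_path_space intro!: sets.Int sets.countable_INT')
qed

lemma sets_avoid_until: "{w \<in> UNIV \<rightarrow> V. \<forall>i<n. w i \<notin> K} \<in> sets (path_space V)"
  using sets_avoid[of "{..<n}" K] by (simp only: Ball_def lessThan_iff)

lemma avoid_step:
  assumes y: "y \<in> V"
  shows "avoid K y = (if y \<in> K then 0 else (\<Sum>z\<in>N y. avoid K z) / real d)"
proof -
  have "(\<forall>n. case_nat y w n \<notin> K) \<longleftrightarrow> y \<notin> K \<and> (\<forall>n. w n \<notin> K)" for w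
    by (subst all_nat_Suc) simp
  then have iff: "(\<lambda>w. w \<in> UNIV \<rightarrow> V \<and> (\<forall>n. case_nat y w n \<notin> K)) =
      (\<lambda>w. w \<in> UNIV \<rightarrow> V \<and> y \<notin> K \<and> (\<forall>n. w n \<notin> K))" by (intro ext) (simp only:)
  have "avoid K y = (\<Sum>z\<in>N y. measure (P z) {w \<in> UNIV \<rightarrow> V. \<forall>n. case_nat y w n \<notin> K}) / real d"
    unfolding avoid_def using sets_avoid[of UNIV K] by (intro prob_step[OF y]) simp
  then show ?thesis unfolding iff by (cases "y \<in> K") (simp_all add: avoid_def)
qed

lemma avoid_until_step:
  assumes y: "y \<in> V"
  shows "avoid_until K (Suc n) y = (if y \<in> K then 0 else (\<Sum>z\<in>N y. avoid_until K n z) / real d)"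
proof -
  have "(\<forall>i<Suc n. case_nat y w i \<notin> K) \<longleftrightarrow> y \<notin> K \<and> (\<forall>i<n. w i \<notin> K)" for w
    by (subst All_less_Suc2) simp
  then have iff: "(\<lambda>w. w \<in> UNIV \<rightarrow> V \<and> (\<forall>i<Suc n. case_nat y w i \<notin> K)) =
      (\<lambda>w. w \<in> UNIV \<rightarrow> V \<and> y \<notin> K \<and> (\<forall>i<n. w i \<notin> K))" by (intro ext) (simp only:)
  have "avoid_until K (Suc n) y =
      (\<Sum>z\<in>N y. measure (P z) {w \<in> UNIV \<rightarrow> V. \<forall>i<Suc n. case_nat y w i \<notin> K}) / real d"
    unfolding avoid_until_def by (intro prob_step[OF y] sets_avoid_until)
  then show ?thesis unfolding iff by (cases "y \<in> K") (simp_all add: avoid_until_def)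
qed

lemma avoid_until_tendsto:
  assumes y: "y \<in> V" shows "(\<lambda>n. avoid_until K n y) \<longlonglongrightarrow> avoid K y"
proof -
  interpret prob_space "P y" using prob_space_P[OF y] .
  have "(\<lambda>n. prob {w \<in> UNIV \<rightarrow> V. \<forall>i<n. w i \<notin> K}) \<longlonglongrightarrow>
      prob (\<Inter>n. {w \<in> UNIV \<rightarrow> V. \<forall>i<n. w i \<notin> K})"
  proof (rule finite_Lim_measure_decseq)
    show "range (\<lambda>n. {w \<in> UNIV \<rightarrow> V. \<forall>i<n. w i \<notin> K}) \<subseteq> events"
      by (simp add: sets_P[OF y] sets_avoid_until image_subset_iff)
    show "decseq (\<lambda>n. {w \<in> UNIV \<rightarrow> V. \<forall>i<n. w i \<notin> K})"
      unfolding decseq_def by (blast intro: less_le_trans)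
  qed
  moreover have "(\<Inter>n::nat. {w \<in> UNIV \<rightarrow> V. \<forall>i<n. w i \<notin> K}) = {w \<in> UNIV \<rightarrow> V. \<forall>n. w n \<notin> K}"
    by auto
  ultimately show ?thesis by (simp add: avoid_until_def avoid_def)
qed

text \<open>A function \<open>g\<close> that equals 1 on \<open>K\<close>, is harmonic off \<open>K\<close> and tends to 0 at infinity is the hitting
probability of \<open>K\<close>. The inequality \<open>1 - g \<le> avoid K\<close> passes to the limit from the probabilities of
avoiding \<open>K\<close> up to a finite time. For the converse, \<open>v = avoid K - (1 - g)\<close> is harmonic off \<open>K\<close>,
vanishes on \<open>K\<close> and satisfies \<open>v \<le> g\<close>. A positive maximum of \<open>v\<close> would therefore be attained on a
finite set and propagate to neighbours with ever smaller \<open>g\<close>, which is impossible.\<close>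

lemma avoid_eq:
  assumes g0: "\<And>y. y \<in> V \<Longrightarrow> 0 \<le> g y"
    and gK: "\<And>y. y \<in> K \<Longrightarrow> g y = 1"
    and g: "\<And>y. y \<in> V \<Longrightarrow> y \<notin> K \<Longrightarrow> (\<Sum>z\<in>N y. g z) = real d * g y"
    and fin: "\<And>\<epsilon>. 0 < \<epsilon> \<Longrightarrow> finite {y \<in> V. \<epsilon> \<le> g y}"
    and down: "\<And>y. y \<in> V \<Longrightarrow> y \<notin> K \<Longrightarrow> \<exists>z\<in>N y. g z < g y"
    and y: "y \<in> V"
  shows "avoid K y = 1 - g y"
proof -
  have d0: "real d > 0" using d_gt_2 by simp
  have lower_n: "1 - g y \<le> avoid_until K n y" if "y \<in> V" for n y
    using that
  proof (induction n arbitrary: y)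
    case 0 then show ?case using g0 prob_UNIV by (simp add: avoid_until_def)
  next
    case (Suc n)
    show ?case
    proof (cases "y \<in> K")
      case True then show ?thesis using gK avoid_until_step[OF Suc.prems] by simp
    next
      case False
      have "real d * (1 - g y) = (\<Sum>z\<in>N y. 1 - g z)"
        using g[OF Suc.prems False] card_N[OF Suc.prems] by (simp add: sum_subtractf algebra_simps)
      also have "\<dots> \<le> (\<Sum>z\<in>N y. avoid_until K n z)"
        using Suc.IH N_subset by (intro sum_mono) auto
      finally show ?thesis using avoid_until_step[OF Suc.prems] False d0
        by (simp add: field_simps)
    qed
  qed
  have lower: "1 - g y \<le> avoid K y" if "y \<in> V" for y
    by (rule LIMSEQ_le_const[OF avoid_until_tendsto[OF that]]) (use lower_n[OF that] in blast)
  have le1: "avoid K y \<le> 1" if "y \<in> V" for y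
    unfolding avoid_def using prob_space.prob_le_1[OF prob_space_P[OF that]] .
  define v where "v y = avoid K y - (1 - g y)" for y
  have v_le: "v y \<le> g y" if "y \<in> V" for y using le1[OF that] by (simp add: v_def)
  have v_K: "v y = 0" if "y \<in> V" "y \<in> K" for y
    using that gK avoid_step[of y K] by (simp add: v_def)
  have v_avg: "(\<Sum>z\<in>N y. v z) = real d * v y" if "y \<in> V" "y \<notin> K" for y
    using avoid_step[OF that(1), of K] g[OF that] card_N[OF that(1)] that(2) d0
    by (simp add: v_def sum_subtractf sum.distrib field_simps)
  have "v y \<le> 0"
  proof (rule ccontr)
    assume "\<not> v y \<le> 0"
    then have pos: "0 < v y" by simp
    \<comment> \<open>Outside \<open>F\<close> the bound \<open>v \<le> g\<close> keeps \<open>v\<close> below \<open>v y\<close>, so the maximum over \<open>F\<close> is global.\<close>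
    define F where "F = {z \<in> V. v y \<le> g z}"
    have F: "finite F" "y \<in> F" unfolding F_def using fin[OF pos] v_le y by auto
    define m where "m = Max (v ` F)"
    have m_ge: "v y \<le> m" unfolding m_def using F by auto
    have le_m: "v z \<le> m" if "z \<in> V" for z
    proof (cases "z \<in> F")
      case True then show ?thesis unfolding m_def using F by auto
    next
      case False then show ?thesis using that v_le[OF that] m_ge by (auto simp: F_def)
    qed
    let ?A = "{z \<in> F. v z = m}"
    have "m \<in> v ` F" unfolding m_def using F by (intro Max_in) auto
    then have A: "finite ?A" "?A \<noteq> {}" using F by auto
    \<comment> \<open>Among the maximisers of \<open>v\<close>, take one with smallest \<open>g\<close>.\<close>
    obtain b where b: "b \<in> ?A" and bmin: "\<And>z. z \<in> ?A \<Longrightarrow> g b \<le> g z"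
      using ex_min_if_finite[of "g ` ?A"] A by (auto simp: not_less)
    have bV: "b \<in> V" and vb: "v b = m" using b by (auto simp: F_def)
    have bK: "b \<notin> K" using v_K[OF bV] vb pos m_ge by auto
    obtain z where z: "z \<in> N b" "g z < g b" using down[OF bV bK] by blast
    have zV: "z \<in> V" using z N_subset by blast
    have "v z = m"
    proof (rule ccontr)
      assume "v z \<noteq> m"
      then have "v z < m" using le_m[OF zV] by simp
      then have "(\<Sum>z\<in>N b. v z) < (\<Sum>z\<in>N b. m)"
        using finite_N[OF bV] z(1) le_m N_subset by (intro sum_strict_mono_ex1) auto
      then show False using v_avg[OF bV bK] card_N[OF bV] vb by simp
    qed
    moreover have "z \<in> F" using v_le[OF zV] \<open>v z = m\<close> m_ge zV by (simp add: F_def)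
    ultimately show False using bmin[of z] z(2) by simp
  qed
  moreover have "0 \<le> v y" using lower[OF y] by (simp add: v_def)
  ultimately show ?thesis by (simp add: v_def)
qed

lemma hitting_time_eq_infinity: "hitting_time K w = \<infinity> \<longleftrightarrow> (\<forall>n\<ge>1. w n \<notin> K)"
  unfolding hitting_time_def top_enat_def[symmetric] INF_top_conv
  by (auto simp: top_enat_def)

lemma escape_prob:
  assumes y: "y \<in> V"
  shows "measure (P y) {w \<in> UNIV \<rightarrow> V. hitting_time K w = \<infinity>} = (\<Sum>z\<in>N y. avoid K z) / real d"
proof -
  have "(\<forall>n\<ge>1. w n \<notin> K) \<longleftrightarrow> (\<forall>n\<in>{1..}. w n \<notin> K)" for w :: "nat \<Rightarrow> 'v" by auto
  moreover have "(\<forall>n\<ge>1. case_nat y w n \<notin> K) \<longleftrightarrow> (\<forall>n. w n \<notin> K)" for w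
    by (subst all_nat_Suc) simp
  ultimately show ?thesis
    using prob_step[OF y, of "\<lambda>w. \<forall>n\<ge>1. w n \<notin> K"] sets_avoid[of "{1..}" K]
    by (simp only: hitting_time_eq_infinity avoid_def)
qed

text \<open>To escape from \<open>y \<in> K\<close> the walk must first step to a child outside \<open>K\<close>, and from such a child it
hits \<open>K\<close> with probability \<open>1 / (d - 1)\<close>.\<close>

lemma escape_prob_ancestral:
  assumes rt: "rooted_regular_tree V E d r par dep" and K: "rooted_regular_tree.ancestral V r par K" "finite K"
    and y: "y \<in> K"
  shows "measure (P y) {w \<in> UNIV \<rightarrow> V. hitting_time K w = \<infinity>} =
    real (card (rooted_regular_tree.children V r par y - K)) * ((real d - 2) / (real d * (real d - 1)))"
proof -
  interpret rooted_regular_tree V E d r par dep by (fact rt)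
  have yV: "y \<in> V" using K y by (auto simp: ancestral_def)
  have av: "avoid K z = 1 - hit K z" if "z \<in> V" for z
    using hit_pos hit_in hit_harmonic[OF K(1)] finite_hit_ge[OF K] hit_smaller_nbr[OF K(1)] that
    by (intro avoid_eq) (auto simp: less_imp_le)
  have "(\<Sum>z\<in>N y. avoid K z) = (\<Sum>z\<in>children y. avoid K z)"
    using sum_nbrs[OF yV, of "avoid K"] K y avoid_step[of "par y" K] yV par_in_V[OF yV]
    by (auto simp: ancestral_def)
  also have "\<dots> = (\<Sum>z\<in>children y - K. avoid K z)"
    using finite_children[OF yV] avoid_step[of _ K] by (intro sum.mono_neutral_right) (auto simp: children_def)
  also have "\<dots> = (\<Sum>z\<in>children y - K. (real d - 2) / (real d - 1))"
  proof (rule sum.cong)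
    fix z assume z: "z \<in> children y - K"
    then have "avoid K z = 1 - 1 / (real d - 1)"
      using av[of z] hit_child[OF K(1), of z y] hit_in[OF y] by (auto simp: children_def)
    then show "avoid K z = (real d - 2) / (real d - 1)" using d_gt_2 by (simp add: field_simps)
  qed simp
  finally show ?thesis using escape_prob[OF yV, of K] by simp
qed

end

section \<open>The law of the vacant set on connected sets\<close>

lemma shift_class_self: "w \<in> trajectories V E \<Longrightarrow> w \<in> shift_class V E w"
  by (auto simp: shift_class_def shift_rel_def intro!: exI[of _ 0])

lemma traj_range_shift_class:
  assumes "w \<in> trajectories V E"
  shows "traj_range (shift_class V E w) = range w"
proof
  show "range w \<subseteq> traj_range (shift_class V E w)"
    using shift_class_self[OF assms] by (auto simp: traj_range_def)
  show "traj_range (shift_class V E w) \<subseteq> range w"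
    by (auto simp: traj_range_def shift_class_def shift_rel_def)
qed

lemma mem_mod_trajectories_entering_iff:
  assumes "w \<in> trajectories V E"
  shows "shift_class V E w \<in> mod_trajectories_entering V E K \<longleftrightarrow> range w \<inter> K \<noteq> {}"
proof
  assume "shift_class V E w \<in> mod_trajectories_entering V E K"
  then obtain w' where w': "w' \<in> trajectories V E" "range w' \<inter> K \<noteq> {}"
    "shift_class V E w = shift_class V E w'"
    by (auto simp: mod_trajectories_entering_def trajectories_entering_def)
  then show "range w \<inter> K \<noteq> {}" using traj_range_shift_class[OF assms] traj_range_shift_class[OF w'(1)]
    by simp
next
  assume "range w \<inter> K \<noteq> {}"
  then show "shift_class V E w \<in> mod_trajectories_entering V E K"
    using assms by (auto simp: mod_trajectories_entering_def trajectories_entering_def)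
qed

lemma space_trajectory_space: "space (trajectory_space V E) = trajectories V E"
  by (auto simp: trajectory_space_def space_restrict_space space_PiM PiE_UNIV_domain trajectories_def)

lemma sets_trajectory_coord:
  "{w \<in> trajectories V E. w n \<in> B} \<in> sets (trajectory_space V E)"
proof -
  have "(\<lambda>w. w n) \<in> measurable (PiM UNIV (\<lambda>_. count_space V)) (count_space V)"
    by (rule measurable_component_singleton) simp
  then have "(\<lambda>w. w n) \<in> measurable (trajectory_space V E) (count_space V)"
    unfolding trajectory_space_def by (rule measurable_restrict_space1)
  from measurable_sets[OF this, of "B \<inter> V"]
  have "(\<lambda>w. w n) -` (B \<inter> V) \<inter> trajectories V E \<in> sets (trajectory_space V E)"
    by (simp add: space_trajectory_space)
  moreover have "(\<lambda>w. w n) -` (B \<inter> V) \<inter> trajectories V E = {w \<in> trajectories V E. w n \<in> B}"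
    by (auto simp: trajectories_def)
  ultimately show ?thesis by simp
qed

lemma space_mod_trajectory_space: "space (mod_trajectory_space V E) = mod_trajectories V E"
  unfolding mod_trajectory_space_def by (rule space_measure_of) auto

lemma shift_class_measurable:
  "shift_class V E \<in> measurable (trajectory_space V E) (mod_trajectory_space V E)"
  unfolding mod_trajectory_space_def
  by (rule measurable_measure_of)
    (auto simp: space_trajectory_space mod_trajectories_def quotient_def shift_class_def)

lemma sets_mod_trajectories_entering:
  "mod_trajectories_entering V E K \<in> sets (mod_trajectory_space V E)"
proof -
  have "shift_class V E -` mod_trajectories_entering V E K \<inter> trajectories V E =
      (\<Union>n. {w \<in> trajectories V E. w n \<in> K})"
    using mem_mod_trajectories_entering_iff by fastforce
  moreover have "mod_trajectories_entering V E K \<subseteq> mod_trajectories V E"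
    by (auto simp: mod_trajectories_entering_def trajectories_entering_def mod_trajectories_def
        quotient_def shift_class_def)
  moreover have "(\<Union>n. {w \<in> trajectories V E. w n \<in> K}) \<in> sets (trajectory_space V E)"
    using sets_trajectory_coord by blast
  ultimately show ?thesis unfolding mod_trajectory_space_def by (intro in_measure_of) auto
qed

lemma fwd_of_trajectory:
  assumes w: "w \<in> trajectories V E"
  shows "(\<lambda>n::nat. w (int n)) \<in> fwd_trajectories V E" "(\<lambda>n::nat. w (- int n)) \<in> fwd_trajectories V E"
proof -
  have fin: "finite {n::nat. w (h n) = x}" if x: "x \<in> V" and h: "inj h" for x and h :: "nat \<Rightarrow> int"
  proof -
    have "finite (h -` {n. w n = x})"
      using w x h by (intro finite_vimageI) (auto simp: trajectories_def)
    then show ?thesis by (simp add: vimage_def)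
  qed
  have inV: "w n \<in> V" and e: "{w n, w (n + 1)} \<in> E" for n
    using w by (auto simp: trajectories_def)
  have e1: "{w (int n), w (int (Suc n))} \<in> E" for n
    using e[of "int n"] by (simp add: add.commute)
  have e2: "{w (- int n), w (- int (Suc n))} \<in> E" for n
    using e[of "- int (Suc n)"] by (simp add: insert_commute)
  show "(\<lambda>n::nat. w (int n)) \<in> fwd_trajectories V E"
    using inV e1 fin[of _ int] by (auto simp: fwd_trajectories_def)
  show "(\<lambda>n::nat. w (- int n)) \<in> fwd_trajectories V E"
    using inV e2 fin[of _ "\<lambda>n. - int n"] by (auto simp: fwd_trajectories_def inj_def)
qed

lemma point_count_eq_0_iff: "point_count I p A \<omega> = 0 \<longleftrightarrow> (\<forall>i\<in>I \<omega>. p \<omega> i \<notin> A)"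
proof
  assume 0: "point_count I p A \<omega> = 0"
  show "\<forall>i\<in>I \<omega>. p \<omega> i \<notin> A"
  proof
    fix i assume i: "i \<in> I \<omega>"
    have "infsum (\<lambda>i. indicator A (p \<omega> i) :: ennreal) {i} \<le> infsum (\<lambda>i. indicator A (p \<omega> i)) (I \<omega>)"
      using i by (intro infsum_mono_neutral nonneg_summable_on_complete) auto
    then have "(indicator A (p \<omega> i) :: ennreal) = 0" using 0 by (simp add: point_count_def)
    then show "p \<omega> i \<notin> A" by (simp split: split_indicator_asm)
  qed
next
  assume "\<forall>i\<in>I \<omega>. p \<omega> i \<notin> A"
  then show "point_count I p A \<omega> = 0" unfolding point_count_def by (intro infsum_0) auto
qed

lemma subset_vacant_set_iff:
  assumes "K \<subseteq> V" and p: "\<And>i. i \<in> J \<Longrightarrow> fst (q i) \<in> mod_trajectories V E \<and> 0 \<le> snd (q i)"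
  shows "K \<subseteq> vacant_set V J q u \<longleftrightarrow>
    (\<forall>i\<in>J. q i \<notin> mod_trajectories_entering V E K \<times> {0..u})"
proof -
  have "fst (q i) \<in> mod_trajectories_entering V E K \<longleftrightarrow> traj_range (fst (q i)) \<inter> K \<noteq> {}"
    if i: "i \<in> J" for i
  proof -
    obtain w where w: "w \<in> trajectories V E" "fst (q i) = shift_class V E w"
      using p[OF i] by (auto simp: mod_trajectories_def quotient_def shift_class_def)
    then show ?thesis
      using mem_mod_trajectories_entering_iff[OF w(1)] traj_range_shift_class[OF w(1)] by simp
  qed
  then have "(\<forall>i\<in>J. q i \<notin> mod_trajectories_entering V E K \<times> {0..u}) \<longleftrightarrow>
      (\<forall>i\<in>J. snd (q i) \<le> u \<longrightarrow> traj_range (fst (q i)) \<inter> K = {})"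
    using p by (auto simp: mem_Times_iff)
  then show ?thesis using assms(1) by (auto simp: vacant_set_def)
qed

context tree_walk
begin

lemma space_fwd: "fwd_trajectories V E \<in> sets (fwd_trajectory_space V E)"
proof -
  have "fwd_trajectories V E = space (fwd_trajectory_space V E)"
    by (auto simp: fwd_trajectory_space_def space_restrict_space space_path_space fwd_trajectories_def)
  then show ?thesis using sets.top by metis
qed

text \<open>Since almost every path of the walk is a nearest-neighbour path with finitely many visits to each
vertex, both conditions on the two half-trajectories have probability one, and only the weight
\<open>e\<^sub>K(x)\<close> of the starting point remains.\<close>

lemma Q_start:
  assumes Q: "is_Q_measure V E a K Q" and x: "x \<in> V"
  shows "emeasure Q {w \<in> trajectories V E. w 0 = x} = ennreal (equilibrium_measure V E a K x)"
proof -
  let ?A = "fwd_trajectories V E"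
  interpret prob_space "P x" using prob_space_P[OF x] .
  have AE: "AE w in P x. w \<in> ?A" using AE_fwd_trajectories[OF x] .
  have H: "{w \<in> UNIV \<rightarrow> V. hitting_time K w = \<infinity>} \<in> events"
    using sets_avoid[of "{1..}" K] unfolding hitting_time_eq_infinity sets_P[OF x]
    by (simp only: Ball_def atLeast_iff)
  have AH: "{w \<in> UNIV \<rightarrow> V. w \<in> ?A \<and> hitting_time K w = \<infinity>} \<in> events"
  proof -
    have "{w \<in> UNIV \<rightarrow> V. w \<in> ?A \<and> hitting_time K w = \<infinity>} =
        ?A \<inter> {w \<in> UNIV \<rightarrow> V. hitting_time K w = \<infinity>}" by auto
    then show ?thesis using H sets_fwd_trajectories sets_P[OF x] by auto
  qed
  have 1: "\<P>(w in P x. w \<in> ?A) = 1"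
  proof -
    have "{w \<in> space (P x). w \<in> ?A} = ?A"
      using space_P[OF x] by (auto simp: fwd_trajectories_def)
    then show ?thesis using AE sets_fwd_trajectories sets_P[OF x] prob_eq_1[of ?A] by simp
  qed
  have "\<P>(w in P x. w \<in> ?A \<and> hitting_time K w = \<infinity>) = \<P>(w in P x. hitting_time K w = \<infinity>)"
    using AE H AH unfolding space_P[OF x] by (intro finite_measure_eq_AE) auto
  then have "\<P>(w in P x. w \<in> ?A \<bar> hitting_time K w = \<infinity>) * equilibrium_measure V E a K x =
      equilibrium_measure V E a K x"
    by (simp add: cond_prob_def equilibrium_measure_def)
  moreover have "{w \<in> trajectories V E. w 0 = x} =
      {w \<in> trajectories V E. (\<lambda>n::nat. w (- int n)) \<in> ?A \<and> w 0 = x \<and> (\<lambda>n::nat. w (int n)) \<in> ?A}"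
    using fwd_of_trajectory by blast
  moreover have "emeasure Q {w \<in> trajectories V E.
        (\<lambda>n::nat. w (- int n)) \<in> ?A \<and> w 0 = x \<and> (\<lambda>n::nat. w (int n)) \<in> ?A} =
      ennreal (\<P>(w in P x. w \<in> ?A \<bar> hitting_time K w = \<infinity>) * equilibrium_measure V E a K x *
        \<P>(w in P x. w \<in> ?A))"
    using Q space_fwd x unfolding is_Q_measure_def by blast
  ultimately show ?thesis by (simp only: 1 mult_1_right)
qed

lemma Q_total:
  assumes Q: "is_Q_measure V E a K Q" and K: "finite K" "K \<subseteq> V"
  shows "emeasure Q (trajectories V E) = ennreal (\<Sum>x\<in>K. equilibrium_measure V E a K x)"
proof -
  let ?S = "\<lambda>x. {w \<in> trajectories V E. w 0 = x}"
  have sets: "?S x \<in> sets Q" for x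
    using sets_trajectory_coord[of V E 0 "{x}"] Q by (simp add: is_Q_measure_def)
  have nonneg: "0 \<le> equilibrium_measure V E a K x" if "x \<in> V" for x
    using vertex_weight_1[OF that] by (simp add: equilibrium_measure_def)
  have "trajectories V E = (\<Union>x\<in>V. ?S x)" by (auto simp: trajectories_def)
  then have "emeasure Q (trajectories V E) = (\<integral>\<^sup>+x. emeasure Q (?S x) \<partial>count_space V)"
    using emeasure_UN_countable[of V ?S Q] sets countable_V by (auto simp: disjoint_family_on_def)
  also have "\<dots> = (\<Sum>x\<in>K. emeasure Q (?S x))"
    using K by (intro nn_integral_count_space') (auto simp: Q_start[OF Q] equilibrium_measure_def)
  also have "\<dots> = (\<Sum>x\<in>K. ennreal (equilibrium_measure V E a K x))"
    using K by (intro sum.cong) (auto simp: Q_start[OF Q])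
  also have "\<dots> = ennreal (\<Sum>x\<in>K. equilibrium_measure V E a K x)"
    using K nonneg by (intro sum_ennreal) auto
  finally show ?thesis .
qed

text \<open>The measure \<open>\<nu>\<close> restricted to the trajectories that enter \<open>K\<close> is the image of \<open>Q\<^sub>K\<close>, so both have the
same total mass, the capacity of \<open>K\<close>.\<close>

lemma intensity_entering:
  assumes \<nu>: "is_interlacement_intensity V E a \<nu>" and K: "finite K" "K \<subseteq> V"
  shows "emeasure \<nu> (mod_trajectories_entering V E K) =
    ennreal (\<Sum>x\<in>K. equilibrium_measure V E a K x)"
proof -
  let ?W = "mod_trajectories_entering V E K"
  from \<nu> have sets: "sets \<nu> = sets (mod_trajectory_space V E)" by (simp add: is_interlacement_intensity_def)
  from \<nu> K obtain Q where Q: "is_Q_measure V E a K Q"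
    and eq: "density \<nu> (indicator ?W) = distr Q (mod_trajectory_space V E) (shift_class V E)"
    unfolding is_interlacement_intensity_def by blast
  have setsQ: "sets Q = sets (trajectory_space V E)" using Q by (simp add: is_Q_measure_def)
  have spQ: "space Q = trajectories V E"
    using sets_eq_imp_space_eq[OF setsQ] space_trajectory_space by simp
  have W: "?W \<in> sets \<nu>" using sets_mod_trajectories_entering sets by simp
  have m: "shift_class V E \<in> measurable Q (mod_trajectory_space V E)"
    using shift_class_measurable setsQ by (simp cong: measurable_cong_sets)
  have "emeasure \<nu> ?W = emeasure (density \<nu> (indicator ?W)) (space \<nu>)"
    using W by (simp add: emeasure_density nn_integral_set_ennreal cong: nn_integral_cong)
  also have "\<dots> = emeasure Q (shift_class V E -` space \<nu> \<inter> space Q)"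
    unfolding eq using m sets by (subst emeasure_distr) (auto simp: sets_eq_imp_space_eq[OF sets])
  also have "shift_class V E -` space \<nu> \<inter> space Q = trajectories V E"
    using measurable_space[OF m] sets_eq_imp_space_eq[OF sets] spQ by auto
  finally show ?thesis using Q_total[OF Q K] by simp
qed

lemma capacity_ancestral:
  assumes rt: "rooted_regular_tree V E d r par dep" and K: "rooted_regular_tree.ancestral V r par K" "finite K"
  shows "(\<Sum>y\<in>K. equilibrium_measure V E a K y) =
    (real d - 2) / (real d * (real d - 1)) * ((real d - 2) * real (card K) + 2)"
proof -
  interpret rooted_regular_tree V E d r par dep by (fact rt)
  let ?c = "(real d - 2) / (real d * (real d - 1))"
  have KV: "K \<subseteq> V" using K by (simp add: ancestral_def)
  have "(\<Sum>y\<in>K. equilibrium_measure V E a K y) = (\<Sum>y\<in>K. real (card (children y - K)) * ?c)"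
  proof (rule sum.cong)
    fix y assume y: "y \<in> K"
    then have yV: "y \<in> V" using KV by blast
    show "equilibrium_measure V E a K y = real (card (children y - K)) * ?c"
      using escape_prob_ancestral[OF rt K y] y vertex_weight_1[OF yV] space_P[OF yV]
      by (simp add: equilibrium_measure_def)
  qed simp
  also have "\<dots> = real (\<Sum>y\<in>K. card (children y - K)) * ?c"
    by (simp only: of_nat_sum sum_distrib_right)
  finally show ?thesis using card_outer_children[OF K] by (simp only: mult.commute)
qed

text \<open>The set \<open>K\<close> is vacant at level \<open>u\<close> when the Poisson process has no point in \<open>W\<^sup>*\<^sub>K \<times> [0, u]\<close>, a set of
intensity \<open>u cap(K)\<close>. The probability is exponential in the cardinality of \<open>K\<close>, up to a constant factor,
as for independent site percolation.\<close>

lemma vacant_prob: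
  assumes RI: "is_random_interlacement V E a M I p"
    and rt: "rooted_regular_tree V E d r par dep" and K: "rooted_regular_tree.ancestral V r par K" "finite K"
    and u: "0 \<le> u"
  shows "{\<omega> \<in> space M. K \<subseteq> vacant_set V (I \<omega>) (p \<omega>) u} \<in> sets M" (is ?meas)
    and "\<P>(\<omega> in M. K \<subseteq> vacant_set V (I \<omega>) (p \<omega>) u) =
      exp (- u * ((real d - 2) / (real d * (real d - 1)) * ((real d - 2) * real (card K) + 2)))" (is ?prob)
proof -
  interpret rooted_regular_tree V E d r par dep by (fact rt)
  have KV: "K \<subseteq> V" using K by (simp add: ancestral_def)
  obtain \<nu> where \<nu>: "is_interlacement_intensity V E a \<nu>"
    and ppp: "poisson_point_process M (\<nu> \<Otimes>\<^sub>M restrict_space lborel {0..}) I p"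
    using RI by (auto simp: is_random_interlacement_def)
  let ?\<Lambda> = "\<nu> \<Otimes>\<^sub>M restrict_space lborel {0::real..}"
  let ?W = "mod_trajectories_entering V E K"
  let ?A = "?W \<times> {0..u}"
  let ?cap = "(real d - 2) / (real d * (real d - 1)) * ((real d - 2) * real (card K) + 2)"
  have cap: "0 \<le> ?cap" using d_gt_2 by simp
  have sets: "sets \<nu> = sets (mod_trajectory_space V E)"
    using \<nu> by (simp add: is_interlacement_intensity_def)
  have W: "?W \<in> sets \<nu>" using sets_mod_trajectories_entering sets by simp
  have u_sets: "{0..u} \<in> sets (restrict_space lborel {0::real..})"
    by (auto simp: sets_restrict_space_iff)
  have A: "?A \<in> sets ?\<Lambda>" using W u_sets by (rule pair_measureI)
  interpret L: sigma_finite_measure "restrict_space lborel {0::real..}"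
    by (rule sigma_finite_measure_restrict_space) (auto intro: lborel.sigma_finite_measure_axioms)
  have "emeasure ?\<Lambda> ?A = emeasure \<nu> ?W * emeasure (restrict_space lborel {0..}) {0..u}"
    using W u_sets by (rule L.emeasure_pair_measure_Times)
  also have "emeasure (restrict_space lborel {0..}) {0..u} = ennreal u"
    using u by (subst emeasure_restrict_space) auto
  also have "emeasure \<nu> ?W = ennreal ?cap"
    using intensity_entering[OF \<nu> K(2) KV] capacity_ancestral[OF rt K] by simp
  also have "ennreal ?cap * ennreal u = ennreal (?cap * u)" using ennreal_mult[OF cap u] by simp
  finally have eA: "emeasure ?\<Lambda> ?A = ennreal (?cap * u)" .
  have mA: "measure ?\<Lambda> ?A = ?cap * u" unfolding measure_def eA using mult_nonneg_nonneg[OF cap u] by simp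
  have sp: "fst (p \<omega> i) \<in> mod_trajectories V E \<and> 0 \<le> snd (p \<omega> i)" if "\<omega> \<in> space M" "i \<in> I \<omega>" for \<omega> i
  proof -
    have "p \<omega> i \<in> space ?\<Lambda>" using ppp that by (auto simp: poisson_point_process_def)
    then show ?thesis
      unfolding space_pair_measure sets_eq_imp_space_eq[OF sets] space_mod_trajectory_space
      by (simp add: mem_Times_iff space_restrict_space)
  qed
  have ev: "{\<omega> \<in> space M. K \<subseteq> vacant_set V (I \<omega>) (p \<omega>) u} = {\<omega> \<in> space M. point_count I p ?A \<omega> = of_nat 0}"
  proof (rule Collect_cong, rule conj_cong[OF refl])
    fix \<omega> assume "\<omega> \<in> space M"
    from subset_vacant_set_iff[OF KV sp[OF this]]
    show "K \<subseteq> vacant_set V (I \<omega>) (p \<omega>) u \<longleftrightarrow> point_count I p ?A \<omega> = of_nat 0"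
      by (simp add: point_count_eq_0_iff)
  qed
  have "point_count I p ?A \<in> borel_measurable M"
    using ppp A by (auto simp: poisson_point_process_def)
  then show ?meas unfolding ev by measurable
  have "\<forall>A\<in>sets ?\<Lambda>. emeasure ?\<Lambda> A < \<infinity> \<longrightarrow> (\<forall>k::nat. \<P>(\<omega> in M. point_count I p A \<omega> = of_nat k) =
      exp (- measure ?\<Lambda> A) * measure ?\<Lambda> A ^ k / fact k)"
    using ppp unfolding poisson_point_process_def by blast
  moreover have "emeasure ?\<Lambda> ?A < \<infinity>" unfolding eA by simp
  ultimately have "\<P>(\<omega> in M. point_count I p ?A \<omega> = of_nat 0) =
      exp (- measure ?\<Lambda> ?A) * measure ?\<Lambda> ?A ^ 0 / fact 0"
    using A by blast
  also have "\<dots> = exp (- u * ?cap)" unfolding mA by (simp add: mult.commute)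
  finally show ?prob unfolding ev .
qed

end

section \<open>First and second moments of vacant lines of ancestors\<close>

text \<open>The Paley-Zygmund bound for the number \<open>N\<close> of events that occur. It comes from taking expectations
in \<open>2 t N - t\<^sup>2 N\<^sup>2 \<le> 1\<^bsub>N > 0\<^esub>\<close>, which is \<open>0 \<le> (1 - t N)\<^sup>2\<close> when \<open>N > 0\<close>; the choice
\<open>t = E N / s\<close> is the best one when only the bound \<open>s\<close> on \<open>E N\<^sup>2\<close> is known.\<close>

lemma (in prob_space) second_moment_union:
  fixes B :: "'i \<Rightarrow> 'a set"
  assumes L: "finite L" and B: "\<And>y. y \<in> L \<Longrightarrow> B y \<in> events"
    and s: "(\<Sum>y\<in>L. \<Sum>z\<in>L. prob (B y \<inter> B z)) \<le> s" "0 < s"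
  shows "(\<Sum>y\<in>L. prob (B y))\<^sup>2 / s \<le> prob (\<Union>y\<in>L. B y)"
proof -
  define N :: "'a \<Rightarrow> real" where "N \<omega> = (\<Sum>y\<in>L. indicator (B y) \<omega>)" for \<omega>
  have int1: "integrable M (indicator (B y) :: 'a \<Rightarrow> real)" if "y \<in> L" for y
    using B[OF that] by (simp add: integrable_indicator_iff emeasure_eq_measure)
  have N2: "(N \<omega>)\<^sup>2 = (\<Sum>y\<in>L. \<Sum>z\<in>L. indicator (B y \<inter> B z) \<omega>)" for \<omega>
    by (simp add: N_def power2_eq_square sum_product indicator_inter_arith)
  have int2: "integrable M (indicator (B y \<inter> B z) :: 'a \<Rightarrow> real)" if "y \<in> L" "z \<in> L" for y z
    using B that by (simp add: integrable_indicator_iff emeasure_eq_measure)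
  have iN: "integrable M N" unfolding N_def using int1 by auto
  have iN2: "integrable M (\<lambda>\<omega>. (N \<omega>)\<^sup>2)" unfolding N2 using int2 by auto
  have EN: "expectation N = (\<Sum>y\<in>L. prob (B y))"
    unfolding N_def using int1 B by (subst Bochner_Integration.integral_sum) auto
  have EN2: "expectation (\<lambda>\<omega>. (N \<omega>)\<^sup>2) = (\<Sum>y\<in>L. \<Sum>z\<in>L. prob (B y \<inter> B z))"
    unfolding N2 using int2 B
    by (subst Bochner_Integration.integral_sum, force)
      (auto intro!: sum.cong simp: Bochner_Integration.integral_sum)
  define t where "t = expectation N / s"
  have U: "(\<Union>y\<in>L. B y) \<in> events" using L B by auto
  have "2 * t * expectation N - t\<^sup>2 * expectation (\<lambda>\<omega>. (N \<omega>)\<^sup>2) =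
      expectation (\<lambda>\<omega>. 2 * t * N \<omega> - t\<^sup>2 * (N \<omega>)\<^sup>2)"
    using iN iN2 by simp
  also have "\<dots> \<le> expectation (indicator (\<Union>y\<in>L. B y))"
  proof (rule integral_mono)
    fix \<omega> assume "\<omega> \<in> space M"
    show "2 * t * N \<omega> - t\<^sup>2 * (N \<omega>)\<^sup>2 \<le> indicator (\<Union>y\<in>L. B y) \<omega>"
    proof (cases "\<omega> \<in> (\<Union>y\<in>L. B y)")
      case True
      have "0 \<le> (1 - t * N \<omega>)\<^sup>2" by simp
      then show ?thesis using True by (simp add: power2_eq_square algebra_simps)
    next
      case False
      then have "N \<omega> = 0" by (auto simp: N_def intro!: sum.neutral)
      then show ?thesis by simp
    qed
  qed (use iN iN2 U in \<open>auto simp: integrable_indicator_iff emeasure_eq_measure\<close>)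
  also have "\<dots> = prob (\<Union>y\<in>L. B y)" using U by simp
  finally have "2 * t * expectation N - t\<^sup>2 * expectation (\<lambda>\<omega>. (N \<omega>)\<^sup>2) \<le> prob (\<Union>y\<in>L. B y)" .
  moreover have "t\<^sup>2 * expectation (\<lambda>\<omega>. (N \<omega>)\<^sup>2) \<le> t\<^sup>2 * s"
    using s(1) unfolding EN2 by (intro mult_left_mono) auto
  moreover have "2 * t * expectation N - t\<^sup>2 * s = (expectation N)\<^sup>2 / s"
    using s(2) by (simp add: t_def power2_eq_square field_simps)
  ultimately show ?thesis unfolding EN by simp
qed

context rooted_regular_tree
begin

definition ancestors :: "'v \<Rightarrow> 'v set" where
  "ancestors y = range (\<lambda>k. (par ^^ k) y)"

lemma ancestors_par: "ancestors y = insert y (ancestors (par y))"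
proof -
  have "ancestors y = insert y (range (\<lambda>k. (par ^^ Suc k) y))"
    unfolding ancestors_def by (subst UNIV_nat_eq) (auto simp: image_image simp del: funpow.simps(2))
  then show ?thesis by (simp add: ancestors_def funpow_Suc_right del: funpow.simps(2))
qed

lemma ancestors_self: "y \<in> ancestors y"
  using ancestors_par[of y] by auto

lemma ancestors_root: "ancestors r = {r}"
proof -
  have "(par ^^ k) r = r" for k by (induction k) (auto simp: par_root)
  then show ?thesis by (auto simp: ancestors_def)
qed

lemma ancestors_dep_le: "y \<in> V \<Longrightarrow> z \<in> ancestors y \<Longrightarrow> dep z \<le> dep y"
proof (induction rule: root_induct)
  case root then show ?case by (simp add: ancestors_root)
next
  case (par y)
  then show ?case using ancestors_par[of y] dep_par[of y] by auto
qed

lemma ancestral_ancestors: "y \<in> V \<Longrightarrow> ancestral (ancestors y)"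
proof (induction rule: root_induct)
  case root then show ?case by (simp add: ancestors_root ancestral_def par_root root_in_V)
next
  case (par y)
  then show ?case using ancestors_par[of y] ancestors_self[of "par y"] by (auto simp: ancestral_def)
qed

lemma finite_ancestors: "y \<in> V \<Longrightarrow> finite (ancestors y)"
  by (induction rule: root_induct) (simp add: ancestors_root, subst ancestors_par, simp)

lemma notin_ancestors_if_deeper: "y \<in> V \<Longrightarrow> dep y < dep z \<Longrightarrow> z \<notin> ancestors y"
  using ancestors_dep_le by fastforce

lemma card_ancestors: "y \<in> V \<Longrightarrow> card (ancestors y) = Suc (dep y)"
proof (induction rule: root_induct)
  case root then show ?case by (simp add: ancestors_root dep_root)
next
  case (par y)
  then show ?case
    using notin_ancestors_if_deeper[of "par y" y] dep_par[of y] par_in_V[of y] finite_ancestors[of "par y"]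
    by (subst ancestors_par) simp
qed

lemma ancestral_Un: "ancestral A \<Longrightarrow> ancestral B \<Longrightarrow> ancestral (A \<union> B)"
  by (auto simp: ancestral_def)

definition level :: "nat \<Rightarrow> 'v set" where
  "level n = {y \<in> V. dep y = n}"

lemma level_0: "level 0 = {r}"
  using dep_eq_0_iff root_in_V by (auto simp: level_def)

lemma level_Suc: "level (Suc n) = (\<Union>y\<in>level n. children y)"
  using dep_par par_in_V dep_root by (fastforce simp: level_def children_def)

lemma finite_level: "finite (level n)"
proof (induction n)
  case (Suc n)
  then show ?case unfolding level_Suc by (auto simp: level_def intro: finite_children)
qed (simp add: level_0)

lemma sum_level_Suc: "(\<Sum>z\<in>level (Suc n). f z) = (\<Sum>y\<in>level n. \<Sum>z\<in>children y. f z)"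
  unfolding level_Suc
  by (intro sum.UNION_disjoint finite_level ballI)
    (auto simp: level_def children_def intro: finite_children[unfolded children_def])

lemma card_children_level: "y \<in> level n \<Longrightarrow> n \<ge> 1 \<Longrightarrow> card (children y) = d - 1"
  using card_children[of y] dep_root by (auto simp: level_def)

lemma card_level: "card (level (Suc n)) = d * (d - 1) ^ n"
proof (induction n)
  case 0
  show ?case using sum_level_Suc[of "\<lambda>_. 1::nat" 0] card_children[OF root_in_V] by (simp add: level_0)
next
  case (Suc n)
  have "card (level (Suc (Suc n))) = (\<Sum>y\<in>level (Suc n). card (children y))"
    using sum_level_Suc[of "\<lambda>_. 1::nat" "Suc n"] by simp
  also have "\<dots> = card (level (Suc n)) * (d - 1)"
    using card_children_level[of _ "Suc n"] by simp
  finally show ?case using Suc by simp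
qed

text \<open>This is the second moment of the number of vertices of generation \<open>n\<close> that are connected to the
root in independent site percolation with retention probability \<open>q\<close>. For the vacant set the second
moment differs from it by a constant factor.\<close>

definition pair_sum :: "real \<Rightarrow> nat \<Rightarrow> real" where
  "pair_sum q n = (\<Sum>y\<in>level n. \<Sum>z\<in>level n. q ^ card (ancestors y \<union> ancestors z))"

text \<open>Two distinct vertices of generation \<open>n + 1\<close> add exactly two new vertices to the union of the lines of
ancestors of their parents. Equal vertices contribute the diagonal term.\<close>

lemma ancestors_pair_le:
  fixes q :: real
  assumes q: "0 \<le> q" and y: "y \<in> level n" "y' \<in> children y" and z: "z \<in> level n" "z' \<in> children z"
  shows "q ^ card (ancestors y' \<union> ancestors z') \<le>
    q\<^sup>2 * q ^ card (ancestors y \<union> ancestors z) + (if y' = z' then q ^ (n + 2) else 0)"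
proof (cases "y' = z'")
  case True
  have "y' \<in> V" "dep y' = Suc n" using y dep_child[OF y(2)] by (auto simp: level_def children_def)
  then have "q ^ card (ancestors y' \<union> ancestors z') = q ^ (n + 2)" using True card_ancestors[of y'] by simp
  moreover have "0 \<le> q\<^sup>2 * q ^ card (ancestors y \<union> ancestors z)"
    using q by (intro mult_nonneg_nonneg zero_le_power)
  ultimately show ?thesis using True by simp
next
  case False
  have V: "y \<in> V" "z \<in> V" and deps: "dep y = n" "dep z = n" "dep y' = Suc n" "dep z' = Suc n"
    and pars: "par y' = y" "par z' = z"
    using y z dep_child by (auto simp: level_def children_def)
  have "ancestors y' \<union> ancestors z' = insert y' (insert z' (ancestors y \<union> ancestors z))"
    using ancestors_par[of y'] ancestors_par[of z'] pars by auto
  moreover have "y' \<notin> ancestors y" "y' \<notin> ancestors z" "z' \<notin> ancestors y" "z' \<notin> ancestors z"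
    using notin_ancestors_if_deeper V deps by auto
  ultimately have "card (ancestors y' \<union> ancestors z') = 2 + card (ancestors y \<union> ancestors z)"
    using False finite_ancestors V by simp
  then show ?thesis using False by (simp add: power2_eq_square)
qed

lemma pair_sum_Suc_le:
  assumes q: "0 \<le> q" and n: "1 \<le> n"
  shows "pair_sum q (Suc n) \<le>
    (q * (real d - 1))\<^sup>2 * pair_sum q n + real (card (level (Suc n))) * q ^ (n + 2)"
proof -
  have "pair_sum q (Suc n) = (\<Sum>y\<in>level n. \<Sum>y'\<in>children y. \<Sum>z\<in>level n. \<Sum>z'\<in>children z.
      q ^ card (ancestors y' \<union> ancestors z'))"
    by (simp add: pair_sum_def sum_level_Suc)
  also have "\<dots> \<le> (\<Sum>y\<in>level n. \<Sum>y'\<in>children y. \<Sum>z\<in>level n. \<Sum>z'\<in>children z.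
      q\<^sup>2 * q ^ card (ancestors y \<union> ancestors z) + (if y' = z' then q ^ (n + 2) else 0))"
    by (intro sum_mono ancestors_pair_le[OF q])
  also have "\<dots> = (\<Sum>y\<in>level n. \<Sum>y'\<in>children y. \<Sum>z\<in>level n. \<Sum>z'\<in>children z.
        q\<^sup>2 * q ^ card (ancestors y \<union> ancestors z)) +
      (\<Sum>y'\<in>level (Suc n). \<Sum>z'\<in>level (Suc n). if y' = z' then q ^ (n + 2) else 0)"
    by (simp add: sum.distrib sum_level_Suc)
  also have "(\<Sum>y'\<in>level (Suc n). \<Sum>z'\<in>level (Suc n). if y' = z' then q ^ (n + 2) else 0) =
      real (card (level (Suc n))) * q ^ (n + 2)"
    using finite_level[of "Suc n"] by (simp add: sum.delta)
  also have "(\<Sum>y\<in>level n. \<Sum>y'\<in>children y. \<Sum>z\<in>level n. \<Sum>z'\<in>children z.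
        q\<^sup>2 * q ^ card (ancestors y \<union> ancestors z)) = (q * (real d - 1))\<^sup>2 * pair_sum q n"
    using card_children_level[OF _ n] d_gt_2
    by (simp add: pair_sum_def sum_distrib_left of_nat_diff power2_eq_square mult_ac)
  finally show ?thesis .
qed

text \<open>With \<open>m = q (d - 1)\<close> the recursion reads \<open>S\<^bsub>n+1\<^esub> \<le> m\<^sup>2 S\<^sub>n + d q\<^sup>2 m\<^sup>n\<close>. For \<open>m > 1\<close> the inhomogeneous
term is of lower order than \<open>m\<^bsup>2n\<^esup>\<close>, and subtracting \<open>B m\<^sup>n\<close> with the right \<open>B\<close> absorbs it in the
induction. The recursion starts at \<open>n = 1\<close> because the root has one child more than the other
vertices.\<close>

lemma pair_sum_bound:
  assumes q: "0 < q" and m: "1 < q * (real d - 1)"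
  shows "\<exists>A>0. \<forall>n\<ge>1. pair_sum q n \<le> A * (q * (real d - 1)) ^ (2 * n)"
proof -
  define m where "m = q * (real d - 1)"
  have m1: "1 < m" using m by (simp add: m_def)
  define B where "B = real d * q\<^sup>2 / (m * (m - 1))"
  have B: "0 \<le> B" using m1 by (simp add: B_def)
  have Beq: "B * m\<^sup>2 - real d * q\<^sup>2 = B * m"
    using m1 by (simp add: B_def power2_eq_square field_simps)
  define A where "A = (pair_sum q 1 + B * m) / m\<^sup>2"
  have "0 < pair_sum q 1"
  proof -
    have "card (level 1) \<noteq> 0" using card_level[of 0] d_gt_2 by simp
    then have "level 1 \<noteq> {}" by (metis card.empty)
    then show ?thesis unfolding pair_sum_def using q finite_level by (intro sum_pos) auto
  qed
  then have A: "0 < A" using m1 B by (simp add: A_def add_pos_nonneg)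
  have "pair_sum q n \<le> A * m ^ (2 * n) - B * m ^ n" if "1 \<le> n" for n
    using that
  proof (induction n rule: dec_induct)
    case base
    show ?case using m1 by (simp add: A_def)
  next
    case (step n)
    then obtain k where k: "n = Suc k" by (cases n) auto
    have lev: "real (card (level (Suc n))) * q ^ (n + 2) = real d * q\<^sup>2 * m ^ n"
      using d_gt_2 by (simp add: card_level m_def power_mult_distrib of_nat_diff power2_eq_square)
    have "pair_sum q (Suc n) \<le> m\<^sup>2 * pair_sum q n + real d * q\<^sup>2 * m ^ n"
      using pair_sum_Suc_le[of q n] q step lev by (simp add: m_def)
    also have "\<dots> \<le> m\<^sup>2 * (A * m ^ (2 * n) - B * m ^ n) + real d * q\<^sup>2 * m ^ n"
      using step.IH by (intro add_right_mono mult_left_mono) auto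
    also have "\<dots> = A * m ^ (2 * Suc n) - (B * m\<^sup>2 - real d * q\<^sup>2) * m ^ n"
      by (simp add: algebra_simps power2_eq_square)
    also have "\<dots> = A * m ^ (2 * Suc n) - B * m ^ Suc n"
      unfolding Beq by simp
    finally show ?case .
  qed
  moreover have "0 \<le> B * m ^ n" for n using B m1 by simp
  ultimately have "\<forall>n\<ge>1. pair_sum q n \<le> A * m ^ (2 * n)" by (smt (verit))
  with A show ?thesis unfolding m_def by blast
qed

text \<open>In a tree, the only way to connect \<open>y\<close> to the root inside \<open>S\<close> is along its line of ancestors.\<close>

lemma mem_component_iff:
  assumes S: "S \<subseteq> V"
  shows "y \<in> component E S r \<longleftrightarrow> y \<in> V \<and> ancestors y \<subseteq> S"
proof
  assume "y \<in> component E S r"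
  then have rS: "r \<in> S" and "(r, y) \<in> {(v, w). v \<in> S \<and> w \<in> S \<and> {v, w} \<in> E}\<^sup>*"
    by (auto simp: component_def)
  from this(2) show "y \<in> V \<and> ancestors y \<subseteq> S"
  proof (induction rule: rtrancl_induct)
    case base then show ?case using rS root_in_V ancestors_root by simp
  next
    case (step y z)
    then have "z \<in> S" "{y, z} \<in> E" by auto
    then show ?case using edge_iff[of y z] step.IH ancestors_par[of y] ancestors_par[of z] by auto
  qed
next
  assume "y \<in> V \<and> ancestors y \<subseteq> S"
  then have "y \<in> V" "ancestors y \<subseteq> S" by auto
  then show "y \<in> component E S r"
  proof (induction rule: root_induct)
    case root then show ?case using ancestors_root by (auto simp: component_def)
  next
    case (par y)
    then have "par y \<in> component E S r" "y \<in> S" "par y \<in> S" "{par y, y} \<in> E"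
      using ancestors_par[of y] ancestors_self[of "par y"] edge_iff[of "par y" y] par_in_V by auto
    then show ?case by (auto simp: component_def intro: rtrancl_into_rtrancl)
  qed
qed

lemma level_par: "y \<in> level (Suc n) \<Longrightarrow> par y \<in> level n \<and> ancestors (par y) \<subseteq> ancestors y"
  using ancestors_par[of y] by (auto simp: level_Suc children_def)

lemma level_ancestor:
  assumes "y \<in> level m" "n \<le> m" shows "\<exists>z\<in>level n. ancestors z \<subseteq> ancestors y"
  using assms(2,1)
proof (induction arbitrary: y rule: dec_induct)
  case (step m)
  then show ?case using level_par[of y m] by (meson order_trans)
qed auto

text \<open>Generations are finite, so an infinite component meets arbitrarily deep ones, and it contains every
ancestor of each of its vertices.\<close>

lemma infinite_component_iff:
  assumes S: "S \<subseteq> V"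
  shows "infinite (component E S r) \<longleftrightarrow> (\<forall>n. \<exists>y\<in>level n. ancestors y \<subseteq> S)"
proof
  assume inf: "infinite (component E S r)"
  show "\<forall>n. \<exists>y\<in>level n. ancestors y \<subseteq> S"
  proof
    fix n
    have "\<not> component E S r \<subseteq> (\<Union>k<n. level k)"
      using inf finite_level by (meson finite_UN_I finite_lessThan finite_subset)
    then obtain y where y': "y \<in> component E S r" "y \<notin> (\<Union>k<n. level k)" by blast
    then have y: "y \<in> V" "ancestors y \<subseteq> S" using mem_component_iff[OF S] by auto
    with y'(2) have "n \<le> dep y" by (auto simp: level_def)
    with y show "\<exists>y\<in>level n. ancestors y \<subseteq> S"
      using level_ancestor[of y "dep y" n] by (force simp: level_def)
  qed
next
  assume *: "\<forall>n. \<exists>y\<in>level n. ancestors y \<subseteq> S"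
  show "infinite (component E S r)"
  proof
    assume "finite (component E S r)"
    then have fin: "finite (dep ` component E S r)" by simp
    have "n \<in> dep ` component E S r" for n
      using *[rule_format, of n] mem_component_iff[OF S] by (force simp: level_def)
    then have "dep ` component E S r = UNIV" by auto
    with fin show False by simp
  qed
qed

end

context tree_walk
begin

text \<open>The expected number of vertices of generation \<open>n + 1\<close> connected to \<open>r\<close> in the vacant set is a constant
times \<open>(q b)\<^sup>n\<close>. If \<open>q b < 1\<close> it tends to 0, and so does the probability of reaching generation
\<open>n\<close>. If \<open>q b > 1\<close> the second moment is of the order of the square of the first, and the probability
of reaching generation \<open>n\<close> is bounded away from 0 uniformly in \<open>n\<close>.\<close>

lemma percolation_dichotomy:
  assumes RI: "is_random_interlacement V E a M I p" and r: "r \<in> V" and u: "0 \<le> u"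
  defines "b \<equiv> real d - 1"
  defines "q \<equiv> exp (- u * (real d - 2)\<^sup>2 / (real d * (real d - 1)))"
  shows "q * b < 1 \<Longrightarrow> percolation_prob V E M I p u r = 0"
    and "1 < q * b \<Longrightarrow> percolation_prob V E M I p u r \<noteq> 0"
proof -
  obtain par dep where rt: "rooted_regular_tree V E d r par dep"
    using regular_tree_rooted[OF d_gt_2 tree r] .
  interpret rooted_regular_tree V E d r par dep by (fact rt)
  interpret prob_space M
    using RI by (auto simp: is_random_interlacement_def poisson_point_process_def)
  define s where "s = exp (- u * (2 * (real d - 2) / (real d * (real d - 1))))"
  have s0: "0 < s" by (simp add: s_def)
  have q0: "0 < q" by (simp add: q_def)
  define vac where "vac K = {\<omega> \<in> space M. K \<subseteq> vacant_set V (I \<omega>) (p \<omega>) u}" for K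
  have vac: "vac K \<in> events" "prob (vac K) = s * q ^ card K" if K: "ancestral K" "finite K" for K
  proof -
    have "- u * ((real d - 2) / (real d * (real d - 1)) * ((real d - 2) * real (card K) + 2)) =
        - u * (2 * (real d - 2) / (real d * (real d - 1))) +
        real (card K) * (- u * (real d - 2)\<^sup>2 / (real d * (real d - 1)))"
      by (simp add: power2_eq_square ring_distribs add_divide_distrib diff_divide_distrib mult_ac)
    then show "prob (vac K) = s * q ^ card K"
      using vacant_prob(2)[OF RI rt K u] unfolding s_def q_def vac_def
      by (simp only: exp_add exp_of_nat_mult)
    show "vac K \<in> events" using vacant_prob(1)[OF RI rt K u] by (simp add: vac_def)
  qed
  have ancestors_vac: "vac (ancestors y) \<in> events" "prob (vac (ancestors y)) = s * q ^ Suc n" if "y \<in> level n" for y n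
    using vac[OF ancestral_ancestors finite_ancestors] card_ancestors that by (auto simp: level_def)
  define A where "A n = (\<Union>y\<in>level n. vac (ancestors y))" for n
  have A: "A n \<in> events" for n unfolding A_def using ancestors_vac finite_level by blast
  have eta: "percolation_prob V E M I p u r = prob (\<Inter>n. A n)"
  proof -
    have "vacant_set V J v u \<subseteq> V" for J v by (auto simp: vacant_set_def)
    then have "{\<omega> \<in> space M. infinite (component E (vacant_set V (I \<omega>) (p \<omega>) u) r)} = (\<Inter>n. A n)"
      by (auto simp: infinite_component_iff A_def vac_def)
    then show ?thesis by (simp add: percolation_prob_def)
  qed
  have b1: "1 < b" using d_gt_2 by (simp add: b_def)
  have EN: "(\<Sum>y\<in>level (Suc n). prob (vac (ancestors y))) = (s * q\<^sup>2 * real d) * (q * b) ^ n" for n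
    using ancestors_vac(2)[of _ "Suc n"] d_gt_2
    by (simp add: card_level b_def power_mult_distrib of_nat_diff power2_eq_square)
  show "percolation_prob V E M I p u r = 0" if sub: "q * b < 1"
  proof -
    have "prob (\<Inter>n. A n) \<le> (s * q\<^sup>2 * real d) * (q * b) ^ n" for n
    proof -
      have "prob (\<Inter>n. A n) \<le> prob (A (Suc n))" using A by (intro finite_measure_mono) auto
      also have "\<dots> \<le> (\<Sum>y\<in>level (Suc n). prob (vac (ancestors y)))"
        unfolding A_def using finite_level ancestors_vac
        by (intro finite_measure_subadditive_finite) auto
      finally show ?thesis using EN by simp
    qed
    moreover have "(\<lambda>n. (s * q\<^sup>2 * real d) * (q * b) ^ n) \<longlonglongrightarrow> (s * q\<^sup>2 * real d) * 0"
      using sub q0 b1 by (intro tendsto_mult tendsto_const LIMSEQ_power_zero) auto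
    ultimately have "prob (\<Inter>n. A n) \<le> 0" by (intro LIMSEQ_le_const) auto
    then show ?thesis unfolding eta using measure_nonneg by (rule antisym)
  qed
  show "percolation_prob V E M I p u r \<noteq> 0" if sup: "1 < q * b"
  proof -
    obtain C where C: "0 < C" "\<And>n. 1 \<le> n \<Longrightarrow> pair_sum q n \<le> C * (q * b) ^ (2 * n)"
      using pair_sum_bound[OF q0] sup unfolding b_def by blast
    define \<kappa> where "\<kappa> = (s * q\<^sup>2 * real d)\<^sup>2 / (s * C * (q * b)\<^sup>2)"
    have \<kappa>: "0 < \<kappa>" using s0 q0 C(1) b1 d_gt_2 by (simp add: \<kappa>_def)
    have low: "\<kappa> \<le> prob (A (Suc n))" for n
    proof -
      let ?m = "(q * b) ^ n"
      have m0: "0 < ?m" using q0 b1 by simp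
      let ?s = "s * C * (q * b)\<^sup>2 * ?m\<^sup>2"
      have "vac (ancestors y) \<inter> vac (ancestors z) = vac (ancestors y \<union> ancestors z)" for y z
        by (auto simp: vac_def)
      then have "(\<Sum>y\<in>level (Suc n). \<Sum>z\<in>level (Suc n). prob (vac (ancestors y) \<inter> vac (ancestors z))) =
          s * pair_sum q (Suc n)"
        using vac(2)[OF ancestral_Un[OF ancestral_ancestors ancestral_ancestors]] finite_ancestors
        by (simp add: pair_sum_def sum_distrib_left level_def)
      also have "\<dots> \<le> s * (C * (q * b) ^ (2 * Suc n))"
        using C(2)[of "Suc n"] s0 by (intro mult_left_mono) auto
      also have "\<dots> = ?s" by (simp add: power2_eq_square power_mult_distrib mult_2 power_add)
      finally have "(\<Sum>y\<in>level (Suc n). prob (vac (ancestors y)))\<^sup>2 / ?s \<le> prob (A (Suc n))"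
        unfolding A_def using s0 C(1) q0 b1 m0 ancestors_vac(1)
        by (intro second_moment_union finite_level) auto
      moreover have "(\<Sum>y\<in>level (Suc n). prob (vac (ancestors y)))\<^sup>2 / ?s = \<kappa>"
        unfolding EN power_mult_distrib \<kappa>_def using m0 by simp
      ultimately show ?thesis by simp
    qed
    have "decseq A"
    proof (rule decseq_SucI)
      show "A (Suc n) \<subseteq> A n" for n
        unfolding A_def vac_def using level_par by fastforce
    qed
    then have "(\<lambda>n. prob (A n)) \<longlonglongrightarrow> prob (\<Inter>n. A n)"
      using A by (intro finite_Lim_measure_decseq) auto
    then have "(\<lambda>n. prob (A (Suc n))) \<longlonglongrightarrow> prob (\<Inter>n. A n)" by (rule LIMSEQ_Suc)
    then have "\<kappa> \<le> prob (\<Inter>n. A n)" by (rule LIMSEQ_le_const) (use low in blast)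
    then show ?thesis using \<kappa> eta by simp
  qed
qed

end

section \<open>The critical value\<close>

theorem corollary5p2:
  fixes V :: "'v set" and E :: "'v set set" and a :: "'v \<Rightarrow> 'v \<Rightarrow> real" and d :: nat
    and M :: "'o measure" and I :: "'o \<Rightarrow> nat set"
    and p :: "'o \<Rightarrow> nat \<Rightarrow> (int \<Rightarrow> 'v) set \<times> real" and x :: 'v
  assumes "2 < d"
    and "regular_tree V E d"
    and "weighted_graph V E a"
    and "\<And>y z. {y, z} \<in> E \<Longrightarrow> a y z = 1 / real d"
    and "is_random_interlacement V E a M I p"
    and "x \<in> V"
  shows "critical_value V E M I p x =
           ereal (real d * (real d - 1) * ln (real d - 1) / (real d - 2)\<^sup>2)"
proof -
  interpret tree_walk V E a d using assms by unfold_locales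
  let ?u = "real d * (real d - 1) * ln (real d - 1) / (real d - 2)\<^sup>2"
  \<comment> \<open>\<open>h u\<close> is the logarithm of the mean offspring number \<open>q (d - 1)\<close> at level \<open>u\<close>.\<close>
  define h where "h u = - u * (real d - 2)\<^sup>2 / (real d * (real d - 1)) + ln (real d - 1)" for u
  have d: "2 < real d" using assms(1) by simp
  have h: "exp (- u * (real d - 2)\<^sup>2 / (real d * (real d - 1))) * (real d - 1) = exp (h u)" for u
    unfolding h_def exp_add using d by simp
  have h_alt: "h u = (?u - u) * ((real d - 2)\<^sup>2 / (real d * (real d - 1)))" for u
    using d by (simp add: h_def left_diff_distrib diff_divide_distrib)
  have c: "0 < (real d - 2)\<^sup>2 / (real d * (real d - 1))" using d by simp
  have above: "percolation_prob V E M I p u x = 0" if "?u < u" "0 \<le> u" for u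
  proof -
    have "h u < 0" unfolding h_alt using that c by (intro mult_neg_pos) auto
    then show ?thesis using percolation_dichotomy(1)[OF assms(5,6) that(2)] h by simp
  qed
  have below: "percolation_prob V E M I p u x \<noteq> 0" if "u < ?u" "0 \<le> u" for u
  proof -
    have "0 < h u" unfolding h_alt using that c by (intro mult_pos_pos) auto
    then show ?thesis using percolation_dichotomy(2)[OF assms(5,6) that(2)] h by simp
  qed
  have u0: "0 \<le> ?u" using d by simp
  show ?thesis unfolding critical_value_def
  proof (rule antisym)
    show "Inf (ereal ` {u. 0 \<le> u \<and> percolation_prob V E M I p u x = 0}) \<le> ereal ?u"
    proof (rule ereal_le_epsilon2)
      fix e :: real assume "0 < e"
      then have "percolation_prob V E M I p (?u + e) x = 0" using u0 by (intro above) auto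
      then have "Inf (ereal ` {u. 0 \<le> u \<and> percolation_prob V E M I p u x = 0}) \<le> ereal (?u + e)"
        using u0 \<open>0 < e\<close> by (intro Inf_lower imageI) auto
      then show "Inf (ereal ` {u. 0 \<le> u \<and> percolation_prob V E M I p u x = 0}) \<le> ereal ?u + ereal e"
        by simp
    qed
    show "ereal ?u \<le> Inf (ereal ` {u. 0 \<le> u \<and> percolation_prob V E M I p u x = 0})"
      using below by (intro Inf_greatest) (fastforce simp: not_less[symmetric])
  qed
qed

end
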